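(* Let $A$ be an arbitrary parameter and, for $m\ge0$, let $$W(m)={}_8W_7\left(A^2/q;\ A/a,\,A/b,\,A/c,\,A/d,\,q^{-m};\ q;\ abcdq^m\right).$$ Then for every integer $n\ge0$, $$2^n\mu_n(a,b,c,d;q) =\sum_{m=0}^n \frac{(aA,bA,cA,dA;q)_m}{(A^2,abcd;q)_m} (-q)^m\, W(m) \sum_{s=0}^{n+1} \left(\binom{n}{s} - \binom{n}{s-1}\right) \sum_{p=0}^{n-2s-m} A^{-n+2s+2p} \begin{bmatrix} m+p\\ m\end{bmatrix}_q \begin{bmatrix} n-2s-p\\ m\end{bmatrix}_q q^{m(-n+2s+p)+\binom{m}{2}}.$$ (In particular the right-hand side is independent of $A$.)
   Context: Let $a,b,c,d,q$ be indeterminates (generic parameters). The monic Askey-Wilson polynomials $P_n(x)=P_n(x;a,b,c,d;q)$ are defined by $P_{-1}=0$, $P_0=1$, $P_{n+1}=(x-b_n)P_n-\lambda_nP_{n-1}$, with $b_n=\frac12(a+a^{-1}-(A_n+C_n))$, $\lambda_n=\frac14A_{n-1}C_n$, where $$A_n=\frac{(1-abq^n)(1-acq^n)(1-adq^n)(1-abcdq^{n-1})}{a(1-abcdq^{2n-1})(1-abcdq^{2n})},\quad C_n=\frac{a(1-q^n)(1-bcq^{n-1})(1-bdq^{n-1})(1-cdq^{n-1})}{(1-abcdq^{2n-2})(1-abcdq^{2n-1})}$$ (for $n=0$ the common factor $1-abcdq^{-1}$ in $A_0$ is cancelled, and $C_0=0$). The moment $\mu_n(a,b,c,d;q)=L(x^n)$,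 where $L$ is the unique linear functional on polynomials in $x$ with $L(1)=1$ and $L(P_n)=0$ for all $n\ge1$ (so that $L(P_mP_n)=0$ for $m\neq n$). It is a rational function of $a,b,c,d,q$, symmetric in $a,b,c,d$. (The parameter $A$ is unrelated to the coefficients $A_n$.) Notation: $(x;q)_m=\prod_{i=0}^{m-1}(1-xq^i)$, $(x_1,\dots,x_r;q)_m=\prod_i(x_i;q)_m$, and $\begin{bmatrix} n\\k\end{bmatrix}_q=\frac{(q;q)_n}{(q;q)_k(q;q)_{n-k}}$ for $0\le k\le n$. Binomial coefficients $\binom nk$ with $k<0$ or $k>n$ are $0$. A sum whose upper limit is smaller than its lower limit is empty. The very-well-poised series is $${}_8W_7(\alpha;x_1,x_2,x_3,x_4,x_5;q;z)=\sum_{j\ge0}\frac{1-\alpha q^{2j}}{1-\alpha}\,\frac{(\alpha,x_1,x_2,x_3,x_4,x_5;q)_j}{(q,\alpha q/x_1,\alpha q/x_2,\alpha q/x_3,\alpha q/x_4,\alpha q/x_5;q)_j}\,z^j;$$ with $x_5=q^{-m}$ it is a finite sum over $0\le j\le m$. Explicitly, $$(aA,bA,cA,dA;q)_m\,W(m)=\sum_{j=0}^m \frac{(A^2/q;q)_j}{(A^2q^m;q)_j}\frac{1-A^2q^{2j-1}}{1-A^2/q}\begin{bmatrix} m\\ j\end{bmatrix}_q(-1)^jq^{\binom j2}(abcd)^j(A/a,A/b,A/c,A/d;q)_j(Aaq^j,Abq^j,Acq^j,Adq^j;q)_{m-j}.$$ *)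

theory Defs
  imports "HOL-Computational_Algebra.Polynomial" "HOL-Library.Groups_Big_Fun"
begin

definition qpoch :: "'a::field \<Rightarrow> 'a \<Rightarrow> nat \<Rightarrow> 'a" where
  "qpoch x q m = (\<Prod>i<m. 1 - x * q ^ i)"

text \<open>The multiple symbol \<open>(x\<^sub>1,\<dots>,x\<^sub>r;q)\<^sub>m\<close>.\<close>

definition qpochs :: "'a::field list \<Rightarrow> 'a \<Rightarrow> nat \<Rightarrow> 'a" where
  "qpochs xs q m = prod_list (map (\<lambda>x. qpoch x q m) xs)"

definition qbinom :: "'a::field \<Rightarrow> nat \<Rightarrow> nat \<Rightarrow> 'a" where
  "qbinom q n k = (if k \<le> n then qpoch q q n / (qpoch q q k * qpoch q q (n - k)) else 0)"

text \<open>Binomial coefficients with an integer lower index, zero outside \<open>0 \<le> k \<le> n\<close>.\<close>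

definition binom_int :: "nat \<Rightarrow> int \<Rightarrow> nat" where
  "binom_int n k = (if k < 0 then 0 else n choose nat k)"

text \<open>
  Over an arbitrary field only terminating series make sense: \<open>Sum_any\<close> adds up the nonzero
  terms, provided that there are finitely many of them.
\<close>

definition W87 :: "'a::field \<Rightarrow> 'a \<Rightarrow> 'a \<Rightarrow> 'a \<Rightarrow> 'a \<Rightarrow> 'a \<Rightarrow> 'a \<Rightarrow> 'a \<Rightarrow> 'a" where
  "W87 \<alpha> x1 x2 x3 x4 x5 q z = Sum_any (\<lambda>j::nat.
     (1 - \<alpha> * q ^ (2 * j)) / (1 - \<alpha>)
     * (qpochs [\<alpha>, x1, x2, x3, x4, x5] q j
        / qpochs [q, \<alpha> * q / x1, \<alpha> * q / x2, \<alpha> * q / x3, \<alpha> * q / x4, \<alpha> * q / x5] q j)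
     * z ^ j)"

lemma W87_terminating:
  fixes q :: "'a::field"
  assumes "q \<noteq> 0"
  shows "W87 \<alpha> x1 x2 x3 x4 (q powi (- int m)) q z = (\<Sum>j\<le>m.
     (1 - \<alpha> * q ^ (2 * j)) / (1 - \<alpha>)
     * (qpochs [\<alpha>, x1, x2, x3, x4, q powi (- int m)] q j
        / qpochs [q, \<alpha> * q / x1, \<alpha> * q / x2, \<alpha> * q / x3, \<alpha> * q / x4,
                  \<alpha> * q / q powi (- int m)] q j)
     * z ^ j)"
proof -
  have "qpoch (q powi (- int m)) q j = 0" if "\<not> j \<le> m" for j
    using that assms unfolding qpoch_def
    by (auto simp: prod_zero_iff power_int_minus intro!: bexI[of _ m])
  then have *: "qpochs [\<alpha>, x1, x2, x3, x4, q powi (- int m)] q j = 0" if "\<not> j \<le> m" for j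
    using that by (simp add: qpochs_def)
  show ?thesis
    unfolding W87_def
  proof (rule Sum_any.expand_superset)
    show "{j. (1 - \<alpha> * q ^ (2 * j)) / (1 - \<alpha>)
     * (qpochs [\<alpha>, x1, x2, x3, x4, q powi (- int m)] q j
        / qpochs [q, \<alpha> * q / x1, \<alpha> * q / x2, \<alpha> * q / x3, \<alpha> * q / x4,
                  \<alpha> * q / q powi (- int m)] q j)
     * z ^ j \<noteq> 0} \<subseteq> {..m}" (is "?S \<subseteq> _")
    proof
      fix j assume "j \<in> ?S"
      then show "j \<in> {..m}" using *[of j] by (cases "j \<le> m") auto
    qed
  qed simp
qed

text \<open>
  Coefficients of the three-term recurrence. In \<open>aw_A\<close> at \<open>n = 0\<close> the factor
  \<open>1 - abcd/q\<close> common to numerator and denominator is cancelled.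
\<close>

definition aw_A :: "'a::field \<Rightarrow> 'a \<Rightarrow> 'a \<Rightarrow> 'a \<Rightarrow> 'a \<Rightarrow> nat \<Rightarrow> 'a" where
  "aw_A a b c d q n =
     (if n = 0 then (1 - a * b) * (1 - a * c) * (1 - a * d) / (a * (1 - a * b * c * d))
      else (1 - a * b * q ^ n) * (1 - a * c * q ^ n) * (1 - a * d * q ^ n)
             * (1 - a * b * c * d * q ^ (n - 1))
           / (a * (1 - a * b * c * d * q ^ (2 * n - 1)) * (1 - a * b * c * d * q ^ (2 * n))))"

definition aw_C :: "'a::field \<Rightarrow> 'a \<Rightarrow> 'a \<Rightarrow> 'a \<Rightarrow> 'a \<Rightarrow> nat \<Rightarrow> 'a" where
  "aw_C a b c d q n =
     (if n = 0 then 0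
      else a * (1 - q ^ n) * (1 - b * c * q ^ (n - 1)) * (1 - b * d * q ^ (n - 1))
             * (1 - c * d * q ^ (n - 1))
           / ((1 - a * b * c * d * q ^ (2 * n - 2)) * (1 - a * b * c * d * q ^ (2 * n - 1))))"

definition aw_b :: "'a::field \<Rightarrow> 'a \<Rightarrow> 'a \<Rightarrow> 'a \<Rightarrow> 'a \<Rightarrow> nat \<Rightarrow> 'a" where
  "aw_b a b c d q n = 1 / 2 * (a + inverse a - (aw_A a b c d q n + aw_C a b c d q n))"

text \<open>Used for \<open>n \<ge> 1\<close> only, since \<open>\<lambda>\<^sub>0\<close> is multiplied by \<open>P\<^sub>-\<^sub>1 = 0\<close>.\<close>

definition aw_lam :: "'a::field \<Rightarrow> 'a \<Rightarrow> 'a \<Rightarrow> 'a \<Rightarrow> 'a \<Rightarrow> nat \<Rightarrow> 'a" where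
  "aw_lam a b c d q n = 1 / 4 * aw_A a b c d q (n - 1) * aw_C a b c d q n"

fun aw_poly :: "'a::field \<Rightarrow> 'a \<Rightarrow> 'a \<Rightarrow> 'a \<Rightarrow> 'a \<Rightarrow> nat \<Rightarrow> 'a poly" where
  "aw_poly a b c d q 0 = 1"
| "aw_poly a b c d q (Suc 0) = [:- aw_b a b c d q 0, 1:]"
| "aw_poly a b c d q (Suc (Suc n)) =
     [:- aw_b a b c d q (Suc n), 1:] * aw_poly a b c d q (Suc n)
     - smult (aw_lam a b c d q (Suc n)) (aw_poly a b c d q n)"

definition is_aw_functional :: "'a::field \<Rightarrow> 'a \<Rightarrow> 'a \<Rightarrow> 'a \<Rightarrow> 'a \<Rightarrow> ('a poly \<Rightarrow> 'a) \<Rightarrow> bool" where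
  "is_aw_functional a b c d q L \<longleftrightarrow>
     Vector_Spaces.linear smult (*) L \<and> L 1 = 1 \<and> (\<forall>n\<ge>1. L (aw_poly a b c d q n) = 0)"

definition aw_functional :: "'a::field \<Rightarrow> 'a \<Rightarrow> 'a \<Rightarrow> 'a \<Rightarrow> 'a \<Rightarrow> 'a poly \<Rightarrow> 'a" where
  "aw_functional a b c d q = (THE L. is_aw_functional a b c d q L)"

definition aw_moment :: "'a::field \<Rightarrow> 'a \<Rightarrow> 'a \<Rightarrow> 'a \<Rightarrow> 'a \<Rightarrow> nat \<Rightarrow> 'a" where
  "aw_moment a b c d q n = aw_functional a b c d q ([:0, 1:] ^ n)"

lemma aw_poly_monic:
  "degree (aw_poly a b c d q n) = n \<and> lead_coeff (aw_poly a b c d q n) = 1"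
proof (induction n rule: less_induct)
  case (less n)
  consider "n = 0" | "n = Suc 0" | k where "n = Suc (Suc k)"
    by (metis nat.exhaust)
  then show ?case
  proof cases
    case 3
    let ?P = "aw_poly a b c d q"
    let ?F = "[:- aw_b a b c d q (Suc k), 1:] * ?P (Suc k)"
    let ?G = "- smult (aw_lam a b c d q (Suc k)) (?P k)"
    have 1: "degree (?P (Suc k)) = Suc k" "lead_coeff (?P (Suc k)) = 1" "degree (?P k) = k"
      using less[of "Suc k"] less[of k] 3 by auto
    then have "?P (Suc k) \<noteq> 0" by auto
    then have dF: "degree ?F = n" using 1 3 by (subst degree_mult_eq) auto
    have lF: "lead_coeff ?F = 1" using 1 by (subst lead_coeff_mult) auto
    have dG: "degree ?G < degree ?F"
      unfolding dF 3 using 1 degree_smult_le[of "aw_lam a b c d q (Suc k)" "?P k"] by simp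
    have "?P n = ?F + ?G" using 3 by simp
    then show ?thesis
      using dF lF degree_add_eq_left[OF dG] lead_coeff_add_le[OF dG]
      by (simp only: add.commute[of ?G ?F])
  qed auto
qed

lemma linear_functional_iff:
  fixes L :: "'a::field poly \<Rightarrow> 'a"
  shows "Vector_Spaces.linear smult (*) L \<longleftrightarrow>
    (\<forall>p r. L (p + r) = L p + L r) \<and> (\<forall>u p. L (smult u p) = u * L p)"
proof -
  have 1: "vector_space (smult :: 'a \<Rightarrow> 'a poly \<Rightarrow> 'a poly)"
    by standard (auto simp: smult_add_right smult_add_left)
  have 2: "vector_space ((*) :: 'a \<Rightarrow> 'a \<Rightarrow> 'a)"
    by standard (auto simp: algebra_simps)
  show ?thesis
    using 1 2 by (auto simp: Vector_Spaces.linear_def module_hom_def module_hom_axioms_def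
        module_iff_vector_space vector_space_pair_def)
qed

lemma linear_functional_expand:
  fixes L :: "'a::field poly \<Rightarrow> 'a"
  assumes "Vector_Spaces.linear smult (*) L"
  shows "L p = (\<Sum>i\<le>degree p. coeff p i * L (monom 1 i))"
proof -
  have add: "L (p + r) = L p + L r" and sm: "L (smult u p) = u * L p" for p r u
    using assms by (auto simp: linear_functional_iff)
  have zero: "L 0 = 0" using sm[of 0 0] by simp
  have "L (\<Sum>i\<in>S. monom (coeff p i) i) = (\<Sum>i\<in>S. coeff p i * L (monom 1 i))"
    if "finite S" for S
    using that
  proof induction
    case (insert x S)
    then show ?case using sm[of "coeff p x" "monom 1 x"] by (simp add: add smult_monom)
  qed (simp add: zero)
  from this[of "{..degree p}"] show ?thesis
    by (simp add: poly_as_sum_of_monoms)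
qed

lemma linear_functional_from_moments:
  fixes f :: "nat \<Rightarrow> 'a::field"
  shows "Vector_Spaces.linear smult (*) (\<lambda>p. \<Sum>i\<le>degree p. coeff p i * f i)"
proof -
  have ext: "(\<Sum>i\<le>degree p. coeff p i * f i) = (\<Sum>i\<le>N. coeff p i * f i)"
    if "degree p \<le> N" for p N
    using that by (intro sum.mono_neutral_left) (auto simp: coeff_eq_0)
  show ?thesis
    unfolding linear_functional_iff
  proof (intro conjI allI)
    fix p r :: "'a poly"
    let ?N = "max (degree p) (degree r)"
    show "(\<Sum>i\<le>degree (p + r). coeff (p + r) i * f i)
        = (\<Sum>i\<le>degree p. coeff p i * f i) + (\<Sum>i\<le>degree r. coeff r i * f i)"
      unfolding ext[of "p + r" ?N, OF degree_add_le_max] ext[of p ?N, OF max.cobounded1]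
        ext[of r ?N, OF max.cobounded2]
      by (simp only: coeff_add ring_distribs sum.distrib)
  next
    fix u and p :: "'a poly"
    show "(\<Sum>i\<le>degree (smult u p). coeff (smult u p) i * f i)
        = u * (\<Sum>i\<le>degree p. coeff p i * f i)"
      by (simp add: ext[of "smult u p" "degree p"] degree_smult_le sum_distrib_left mult.assoc)
  qed
qed

fun aw_mu_rec :: "(nat \<Rightarrow> 'a::field poly) \<Rightarrow> nat \<Rightarrow> 'a" where
  "aw_mu_rec P n = (if n = 0 then 1 else - (\<Sum>k\<in>{..<n}. coeff (P n) k * aw_mu_rec P k))"

declare aw_mu_rec.simps [simp del]

lemma ex1_aw_functional: "\<exists>!L. is_aw_functional a b c d q L"
proof -
  let ?P = "aw_poly a b c d q"
  have expand: "L (?P n) = L (monom 1 n) + (\<Sum>k<n. coeff (?P n) k * L (monom 1 k))"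
    if "Vector_Spaces.linear smult (*) L" for L n
  proof -
    have "L (?P n) = (\<Sum>k\<le>n. coeff (?P n) k * L (monom 1 k))"
      using linear_functional_expand[OF that, of "?P n"] aw_poly_monic[of a b c d q n] by simp
    moreover have "coeff (?P n) n = 1"
      using aw_poly_monic[THEN conjunct2, of a b c d q n]
      unfolding aw_poly_monic[THEN conjunct1] .
    ultimately show ?thesis
      unfolding lessThan_Suc_atMost[symmetric] sum.lessThan_Suc by (simp only: mult_1_left add.commute)
  qed
  define L0 where "L0 = (\<lambda>p. \<Sum>i\<le>degree p. coeff p i * aw_mu_rec ?P i)"
  have lin: "Vector_Spaces.linear smult (*) L0"
    unfolding L0_def by (rule linear_functional_from_moments)
  have mon: "L0 (monom 1 n) = aw_mu_rec ?P n" for n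
  proof -
    have "L0 (monom 1 n) = (\<Sum>i\<le>n. if i = n then aw_mu_rec ?P i else 0)"
      unfolding L0_def by (rule sum.cong) (auto simp: degree_monom_eq)
    then show ?thesis by simp
  qed
  show ?thesis
  proof (rule ex1I)
    have "L0 1 = 1"
      using mon[of 0] by (simp add: aw_mu_rec.simps[of _ 0])
    moreover have "L0 (?P n) = 0" if "n \<ge> 1" for n
      using expand[OF lin, of n] that by (simp add: mon aw_mu_rec.simps[of _ n])
    ultimately show "is_aw_functional a b c d q L0"
      unfolding is_aw_functional_def using lin by blast
  next
    fix L assume L: "is_aw_functional a b c d q L"
    then have linL: "Vector_Spaces.linear smult (*) L" and L1: "L 1 = 1"
      and LP: "\<And>n. n \<ge> 1 \<Longrightarrow> L (?P n) = 0"
      unfolding is_aw_functional_def by blast+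
    have "L (monom 1 n) = aw_mu_rec ?P n" for n
    proof (induction n rule: less_induct)
      case (less n)
      show ?case
      proof (cases "n = 0")
        case True
        then show ?thesis using L1 by (simp add: aw_mu_rec.simps[of _ 0])
      next
        case False
        then have "L (monom 1 n) = - (\<Sum>k<n. coeff (?P n) k * L (monom 1 k))"
          using expand[OF linL, of n] LP[of n] by (simp add: eq_neg_iff_add_eq_0)
        also have "\<dots> = aw_mu_rec ?P n"
          using False less by (simp add: aw_mu_rec.simps[of _ n])
        finally show ?thesis .
      qed
    qed
    then have "L p = L0 p" for p
      by (subst linear_functional_expand[OF linL]) (simp add: L0_def)
    then show "L = L0" ..
  qed
qed

lemma is_aw_functional_aw_functional: "is_aw_functional a b c d q (aw_functional a b c d q)"
  unfolding aw_functional_def by (rule theI'[OF ex1_aw_functional])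

end

theory Submission
  imports Defs "HOL-Computational_Algebra.Formal_Power_Series"
begin

unbundle fps_syntax

text \<open>
  Write \<open>\<phi>\<^sub>m(x;A) = \<Prod>\<^bsub>i<m\<^esub> (1 - 2xAq\<^sup>i + A\<^sup>2q\<^bsup>2i\<^esup>)\<close>. Expanding \<open>(2x)\<^sup>n\<close> into Chebyshev polynomials of the second
  kind and these into the \<open>\<phi>\<^sub>m(x;A)\<close> gives the inner double sum, so everything reduces to
  \<open>M\<^sub>m(a) = L(\<phi>\<^sub>m(x;A))\<close>. For \<open>A = a\<close> this value is read off from the explicit expansion of \<open>\<phi>\<^sub>m(x;a)\<close>
  in Askey-Wilson polynomials. It follows that multiplying the argument of \<open>L\<close> by \<open>1 - 2ax + a\<^sup>2\<close> amounts to
  replacing \<open>a\<close> by \<open>aq\<close>, up to a constant. As \<open>1 - 2xAq\<^sup>m + A\<^sup>2q\<^bsup>2m\<^esup>\<close> is a linear combination of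
  \<open>1 - 2ax + a\<^sup>2\<close> and \<open>1\<close>, one gets \<open>M\<^sub>m\<^sub>+\<^sub>1(a)\<close> from \<open>M\<^sub>m(aq)\<close> and \<open>M\<^sub>m(a)\<close>, and the very-well-poised sum
  satisfies the same recurrence because the difference of its two sides telescopes.
\<close>

section \<open>Powers of \<open>x\<close> in the basis \<open>\<phi>\<^sub>m(x;A)\<close>\<close>

text \<open>For \<open>x = cos \<theta>\<close> this is the product
  \<open>(A e^{i\<theta>}, A e^{-i\<theta>}; q)_m\<close>.\<close>

definition aw_basis :: "'a::field \<Rightarrow> 'a \<Rightarrow> nat \<Rightarrow> 'a poly" where
  "aw_basis A q m = (\<Prod>i<m. [:1 + A\<^sup>2 * q ^ (2 * i), - 2 * A * q ^ i:])"

lemma aw_basis_0 [simp]: "aw_basis A q 0 = 1"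
  by (simp add: aw_basis_def)

lemma aw_basis_Suc:
  "aw_basis A q (Suc m) = [:1 + A\<^sup>2 * q ^ (2 * m), - 2 * A * q ^ m:] * aw_basis A q m"
  unfolding aw_basis_def by (simp only: prod.lessThan_Suc mult.commute)

text \<open>Splitting off the first factor instead of the last replaces \<open>A\<close> by
  \<open>A * q\<close>. For A = a this is the source of the shift from a to aq.\<close>

lemma aw_basis_Suc_shift:
  "aw_basis A q (Suc m) = [:1 + A\<^sup>2, - 2 * A:] * aw_basis (A * q) q m"
  unfolding aw_basis_def prod.lessThan_Suc_shift
  by (simp add: power_mult_distrib algebra_simps power2_eq_square power_add)

text \<open>The next factor of the product is solved for 2x.\<close>

lemma aw_basis_mult_x:
  fixes A q :: "'a::field"
  assumes q0: "q \<noteq> 0" and A0: "A \<noteq> 0"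
  shows "[:0, 2:] * aw_basis A q m =
     smult (A * q ^ m + 1 / (A * q ^ m)) (aw_basis A q m) - smult (1 / (A * q ^ m)) (aw_basis A q (Suc m))"
proof -
  have "[:0, 2:] = [:A * q ^ m + 1 / (A * q ^ m):] - smult (1 / (A * q ^ m)) [:1 + A\<^sup>2 * q ^ (2 * m), - 2 * A * q ^ m:]"
    using A0 q0 by (simp add: field_simps power2_eq_square power_mult power_even_eq)
  moreover have "[:c:] * p = smult c p" for c :: 'a and p
    by simp
  ultimately show ?thesis
    by (simp only: aw_basis_Suc left_diff_distrib mult_smult_left)
qed

section \<open>q-Pochhammer symbols, q-binomials and their generating series\<close>

lemma choose_two_Suc: "Suc n choose 2 = (n choose 2) + n"
  by (simp add: numeral_2_eq_2)

lemma qpoch_0 [simp]: "qpoch x q 0 = 1"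
  by (simp add: qpoch_def)

lemma qpoch_Suc: "qpoch x q (Suc n) = qpoch x q n * (1 - x * q ^ n)"
  by (simp add: qpoch_def)

lemma qpoch_Suc_shift: "qpoch x q (Suc n) = (1 - x) * qpoch (x * q) q n"
  unfolding qpoch_def prod.lessThan_Suc_shift by (simp add: mult.assoc)

lemma qpoch_nonzero: "(\<And>i. i < n \<Longrightarrow> x * q ^ i \<noteq> 1) \<Longrightarrow> qpoch x q n \<noteq> 0"
  by (force simp: qpoch_def)

lemma qpoch_q_nonzero:
  assumes "\<And>k::nat. k \<ge> 1 \<Longrightarrow> q ^ k \<noteq> (1::'a::field)"
  shows "qpoch q q n \<noteq> 0"
  by (rule qpoch_nonzero) (use assms[of "Suc _"] in simp)

lemma qbinom_eq_0 [simp]: "n < k \<Longrightarrow> qbinom q n k = 0"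
  by (simp add: qbinom_def)

text \<open>\<open>qbinom_fps q u m\<close> is the power series \<open>1 / ((1 - u X) (1 - u q X) \<dots> (1 - u q\<^sup>m X))\<close>.\<close>

definition qbinom_fps :: "'a::field \<Rightarrow> 'a \<Rightarrow> nat \<Rightarrow> 'a fps" where
  "qbinom_fps q u m = Abs_fps (\<lambda>p. qbinom q (m + p) m * u ^ p)"

lemma qbinom_fps_nth [simp]: "qbinom_fps q u m $ p = qbinom q (m + p) m * u ^ p"
  by (simp add: qbinom_fps_def)

lemma fps_linear_mult_nth:
  fixes F :: "'a::field fps"
  shows "((1 - fps_const u * fps_X) * F) $ 0 = F $ 0"
    "((1 - fps_const u * fps_X) * F) $ Suc p = F $ Suc p - u * F $ p"
  by (simp_all add: left_diff_distrib mult.assoc)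

context
  fixes q :: "'a::field"
  assumes q_generic: "\<And>k::nat. k \<ge> 1 \<Longrightarrow> q ^ k \<noteq> 1"
begin

lemma one_minus_q_power: "1 - q * q ^ k \<noteq> 0"
  using q_generic[of "Suc k"] by simp

lemma qbinom_0 [simp]: "qbinom q n 0 = 1"
  using qpoch_q_nonzero[OF q_generic] by (simp add: qbinom_def)

lemma qbinom_self [simp]: "qbinom q n n = 1"
  using qpoch_q_nonzero[OF q_generic] by (simp add: qbinom_def)

lemma qbinom_add: "qbinom q (m + p) m = qpoch q q (m + p) / (qpoch q q m * qpoch q q p)"
  by (simp add: qbinom_def)

text \<open>Coefficient form of stripping the last factor 1 - uq^(m+1)X from the product behind
  \<open>qbinom_fps\<close>; \<open>qbinom_pascal_upper\<close> does the same for the first factor 1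
  - uX.\<close>

lemma qbinom_pascal_lower:
  "qbinom q (Suc m + Suc p) (Suc m) = qbinom q (m + Suc p) m + q ^ Suc m * qbinom q (Suc m + p) (Suc m)"
proof -
  note nz = qpoch_q_nonzero[OF q_generic] one_minus_q_power
  show ?thesis
    unfolding qbinom_add using nz[of m] nz[of p]
    by (simp add: qpoch_Suc divide_simps one_minus_q_power) (simp add: algebra_simps power_add)
qed

lemma qbinom_pascal_upper:
  "qbinom q (Suc m + Suc p) (Suc m) = q ^ Suc p * qbinom q (m + Suc p) m + qbinom q (Suc m + p) (Suc m)"
proof -
  note nz = qpoch_q_nonzero[OF q_generic] one_minus_q_power
  show ?thesis
    unfolding qbinom_add using nz[of m] nz[of p]
    by (simp add: qpoch_Suc divide_simps one_minus_q_power) (simp add: algebra_simps power_add)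
qed

lemma qbinom_fps_0: "(1 - fps_const u * fps_X) * qbinom_fps q u 0 = 1"
proof (rule fps_ext)
  fix p show "((1 - fps_const u * fps_X) * qbinom_fps q u 0) $ p = 1 $ p"
    by (cases p) (simp_all add: fps_linear_mult_nth)
qed

lemma qbinom_fps_last:
  "(1 - fps_const (u * q ^ Suc m) * fps_X) * qbinom_fps q u (Suc m) = qbinom_fps q u m"
proof (rule fps_ext)
  fix p show "((1 - fps_const (u * q ^ Suc m) * fps_X) * qbinom_fps q u (Suc m)) $ p = qbinom_fps q u m $ p"
  proof (cases p)
    case (Suc p')
    show ?thesis unfolding Suc fps_linear_mult_nth qbinom_fps_nth qbinom_pascal_lower
      by (simp add: algebra_simps)
  qed (simp_all add: fps_linear_mult_nth)
qed

lemma qbinom_fps_first: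
  "(1 - fps_const u * fps_X) * qbinom_fps q u (Suc m) = qbinom_fps q (u * q) m"
proof (rule fps_ext)
  fix p show "((1 - fps_const u * fps_X) * qbinom_fps q u (Suc m)) $ p = qbinom_fps q (u * q) m $ p"
  proof (cases p)
    case (Suc p')
    show ?thesis unfolding Suc fps_linear_mult_nth qbinom_fps_nth qbinom_pascal_upper
      by (simp add: algebra_simps power_mult_distrib)
  qed (simp_all add: fps_linear_mult_nth)
qed

end

section \<open>Chebyshev polynomials in the basis \<phi>_m(x;A)\<close>

fun cheb_U :: "nat \<Rightarrow> 'a::comm_ring_1 poly" where
  "cheb_U 0 = 1"
| "cheb_U (Suc 0) = [:0, 2:]"
| "cheb_U (Suc (Suc n)) = [:0, 2:] * cheb_U (Suc n) - cheb_U n"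

context
  fixes q A :: "'a::field"
  assumes q_generic: "\<And>k::nat. k \<ge> 1 \<Longrightarrow> q ^ k \<noteq> 1" and q0: "q \<noteq> 0" and A0: "A \<noteq> 0"
begin

text \<open>Generating function over N of the coefficient of \<phi>_m in U_N. The prefactor is the
  product of -1/(Aq^i) over i < m, and the two series are the reciprocals of the products of 1 -
  Aq^iX and of 1 - X/(Aq^i) over i \<le> m.\<close>

definition cheb_fps :: "nat \<Rightarrow> 'a fps" where
  "cheb_fps m = fps_const ((- q) ^ m * q ^ (m choose 2) / (q ^ (m * m) * A ^ m)) * fps_X ^ m
     * (qbinom_fps q A m * qbinom_fps q (1 / (A * q ^ m)) m)"

lemma fps_quadratic_factor:
  fixes u v :: 'a
  shows "1 - fps_const (u + v) * fps_X + fps_const (u * v) * fps_X\<^sup>2 =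
    (1 - fps_const u * fps_X) * (1 - fps_const v * fps_X)"
  by (simp add: algebra_simps power2_eq_square flip: fps_const_add fps_const_mult)

lemma cheb_fps_0:
  "(1 - fps_const (A + 1 / A) * fps_X + fps_X\<^sup>2) * cheb_fps 0 = 1"
proof -
  have "1 - fps_const (A + 1 / A) * fps_X + fps_X\<^sup>2 =
    (1 - fps_const A * fps_X) * (1 - fps_const (1 / A) * fps_X)"
    using fps_quadratic_factor[of A "1/A"] A0 by simp
  then have "(1 - fps_const (A + 1 / A) * fps_X + fps_X\<^sup>2) * cheb_fps 0 =
     ((1 - fps_const A * fps_X) * qbinom_fps q A 0) * ((1 - fps_const (1 / A) * fps_X) * qbinom_fps q (1 / A) 0)"
    by (simp add: cheb_fps_def mult_ac binomial_eq_0)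
  then show ?thesis by (simp only: qbinom_fps_0[OF q_generic] mult_1)
qed

text \<open>With u = Aq^(m+1) the quadratic is (1 - uX)(1 - X/u). These are the last factor behind
  one q-binomial series and the first factor behind the other, so cancelling them lowers m by
  one.\<close>

lemma cheb_fps_Suc:
  "(1 - fps_const (A * q ^ Suc m + 1 / (A * q ^ Suc m)) * fps_X + fps_X\<^sup>2) * cheb_fps (Suc m)
   = fps_const (- 1 / (A * q ^ m)) * fps_X * cheb_fps m"
proof -
  define \<kappa> where "\<kappa> m = (- q) ^ m * q ^ (m choose 2) / (q ^ (m * m) * A ^ m)" for m
  have \<kappa>: "\<kappa> (Suc m) = - 1 / (A * q ^ m) * \<kappa> m"
    unfolding \<kappa>_def using A0 q0
    by (simp add: divide_simps choose_two_Suc power_add mult_ac)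
  define u where "u = A * q ^ Suc m"
  have "1 - fps_const (u + 1 / u) * fps_X + fps_X\<^sup>2 =
    (1 - fps_const u * fps_X) * (1 - fps_const (1 / u) * fps_X)"
    using fps_quadratic_factor[of u "1/u"] A0 q0 by (simp add: u_def)
  then have "(1 - fps_const (u + 1 / u) * fps_X + fps_X\<^sup>2) * cheb_fps (Suc m) =
     fps_const (\<kappa> (Suc m)) * fps_X ^ Suc m *
     (((1 - fps_const u * fps_X) * qbinom_fps q A (Suc m)) * ((1 - fps_const (1 / u) * fps_X) * qbinom_fps q (1 / u) (Suc m)))"
    by (simp add: cheb_fps_def mult_ac \<kappa>_def u_def)
  also have "\<dots> = fps_const (\<kappa> (Suc m)) * fps_X ^ Suc m * (qbinom_fps q A m * qbinom_fps q (1 / (A * q ^ m)) m)"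
  proof -
    have "1 / u * q = 1 / (A * q ^ m)" using q0 by (simp add: u_def)
    then show ?thesis
      using qbinom_fps_last[OF q_generic, of A m] qbinom_fps_first[OF q_generic, of "1 / u" m]
      by (simp only: u_def)
  qed
  also have "\<dots> = fps_const (- 1 / (A * q ^ m)) * fps_X * cheb_fps m"
    unfolding \<kappa> cheb_fps_def \<kappa>_def[symmetric] fps_const_mult[symmetric] power_Suc
    by (simp only: mult_ac)
  finally show ?thesis unfolding u_def .
qed

lemma fps_quadratic_mult_nth:
  fixes F :: "'a fps"
  shows "((1 - fps_const u * fps_X + fps_X\<^sup>2) * F) $ Suc (Suc n) = F $ Suc (Suc n) - u * F $ Suc n + F $ n"
  by (simp add: ring_distribs power2_eq_square mult.assoc)

text \<open>Coefficientwise, the quadratic relations are the recurrence that U_(N+2) = 2x U_(N+1) -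
  U_N imposes on the expansion coefficients, 2x acting as in \<open>aw_basis_mult_x\<close>.\<close>

lemma cheb_fps_recurrence:
  "cheb_fps m $ Suc (Suc N) = (A * q ^ m + 1 / (A * q ^ m)) * cheb_fps m $ Suc N
     - (if m = 0 then 0 else cheb_fps (m - 1) $ Suc N / (A * q ^ (m - 1))) - cheb_fps m $ N"
proof (cases m)
  case 0
  show ?thesis
    using arg_cong[OF cheb_fps_0, of "\<lambda>F. F $ Suc (Suc N)"]
    unfolding fps_quadratic_mult_nth by (simp add: 0 algebra_simps)
next
  case (Suc m')
  show ?thesis
    using arg_cong[OF cheb_fps_Suc[of m'], of "\<lambda>F. F $ Suc (Suc N)"]
    unfolding fps_quadratic_mult_nth by (simp add: Suc algebra_simps)
qed

lemma cheb_fps_nth_0: "N < m \<Longrightarrow> cheb_fps m $ N = 0"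
  by (simp add: cheb_fps_def mult.assoc fps_X_power_mult_nth)

text \<open>The bound \<open>M\<close> is left free so that expansions of different degrees can be
  compared over one index range; the surplus coefficients vanish.\<close>

lemma cheb_U_expansion: "N \<le> M \<Longrightarrow> cheb_U N = (\<Sum>m\<le>M. smult (cheb_fps m $ N) (aw_basis A q m))"
proof (induction N arbitrary: M rule: cheb_U.induct)
  case 1
  have "(\<Sum>m\<le>M. smult (cheb_fps m $ 0) (aw_basis A q m)) = (\<Sum>m\<in>{0}. smult (cheb_fps m $ 0) (aw_basis A q m))"
    by (rule sum.mono_neutral_right) (auto simp: cheb_fps_nth_0)
  then show ?case by (simp add: cheb_fps_def binomial_eq_0 qbinom_0[OF q_generic])
next
  case 2
  have "(\<Sum>m\<le>M. smult (cheb_fps m $ Suc 0) (aw_basis A q m)) = (\<Sum>m\<in>{0,1}. smult (cheb_fps m $ Suc 0) (aw_basis A q m))"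
    by (rule sum.mono_neutral_right) (use 2 in \<open>auto simp: cheb_fps_nth_0\<close>)
  also have "\<dots> = [:0, 2:]"
    using A0 q0 by (simp add: cheb_fps_def aw_basis_def fps_mult_nth mult.assoc binomial_eq_0 qbinom_0[OF q_generic] qbinom_self[OF q_generic] field_simps power2_eq_square)
  finally show ?case by simp
next
  case (3 N)
  \<comment> \<open>Multiplication by 2x raises the basis index by one, so U_(N+1) is expanded up to
    \<open>M'\<close> only.\<close>
  then obtain M' where M: "M = Suc M'" "Suc N \<le> M'" by (cases M) auto
  let ?c = "\<lambda>m N. cheb_fps m $ N" and ?\<phi> = "aw_basis A q"
  let ?\<mu> = "\<lambda>m. A * q ^ m + 1 / (A * q ^ m)" and ?\<nu> = "\<lambda>m. 1 / (A * q ^ m)"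
  have "[:0, 2:] * cheb_U (Suc N) = (\<Sum>m\<le>M'. smult (?c m (Suc N)) ([:0, 2:] * ?\<phi> m))"
    unfolding "3.IH"(1)[OF M(2)] sum_distrib_left mult_smult_right ..
  also have "\<dots> = (\<Sum>m\<le>M'. smult (?\<mu> m * ?c m (Suc N)) (?\<phi> m)) - (\<Sum>m\<le>M'. smult (?\<nu> m * ?c m (Suc N)) (?\<phi> (Suc m)))"
    unfolding aw_basis_mult_x[OF q0 A0] by (simp add: smult_diff_right sum_subtractf mult_ac)
  \<comment> \<open>The added term has index \<open>M\<close> > N + 1 and hence coefficient
    zero.\<close>
  also have "(\<Sum>m\<le>M'. smult (?\<mu> m * ?c m (Suc N)) (?\<phi> m)) = (\<Sum>m\<le>M. smult (?\<mu> m * ?c m (Suc N)) (?\<phi> m))"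
    using M by (simp add: cheb_fps_nth_0)
  also have "(\<Sum>m\<le>M'. smult (?\<nu> m * ?c m (Suc N)) (?\<phi> (Suc m))) =
     (\<Sum>m\<le>M. smult (if m = 0 then 0 else ?c (m - 1) (Suc N) / (A * q ^ (m - 1))) (?\<phi> m))"
    unfolding M sum.atMost_Suc_shift by simp
  finally show ?case
    unfolding cheb_U.simps "3.IH"(2)[of M, OF le_trans[OF _ "3.prems"], simplified] cheb_fps_recurrence
      smult_diff_left sum_subtractf
    by (simp add: algebra_simps)
qed

text \<open>The Cauchy product of the two q-binomial series; with N = m + p + r the exponents
  combine into the stated integer powers.\<close>

lemma cheb_fps_nth:
  assumes "m \<le> N"
  shows "cheb_fps m $ N = (- q) ^ m * (\<Sum>p\<le>N - m.
     A powi (- int N + 2 * int p) * qbinom q (m + p) m * qbinom q (N - p) m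
     * q powi (int m * (- int N + int p) + int (m choose 2)))"
proof -
  have "cheb_fps m $ N = (\<Sum>p\<le>N - m. (- q) ^ m * q ^ (m choose 2) / (q ^ (m * m) * A ^ m) *
     (qbinom q (m + p) m * A ^ p * (qbinom q (m + (N - m - p)) m * (1 / (A * q ^ m)) ^ (N - m - p))))"
  proof -
    have "cheb_fps m $ N = (- q) ^ m * q ^ (m choose 2) / (q ^ (m * m) * A ^ m) *
        (qbinom_fps q A m * qbinom_fps q (1 / (A * q ^ m)) m) $ (N - m)"
      using assms unfolding cheb_fps_def mult.assoc fps_mult_left_const_nth fps_X_power_mult_nth
      by simp
    then show ?thesis
      by (simp only: fps_mult_nth qbinom_fps_nth sum_distrib_left atLeast0AtMost)
  qed
  also have "\<dots> = (\<Sum>p\<le>N - m. (- q) ^ m * (A powi (- int N + 2 * int p) * qbinom q (m + p) m * qbinom q (N - p) m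
     * q powi (int m * (- int N + int p) + int (m choose 2))))"
  proof (rule sum.cong[OF refl])
    fix p assume "p \<in> {..N - m}"
    then obtain r where N: "N = m + p + r" using assms
      by (metis atMost_iff le_add_diff_inverse Nat.le_diff_conv2 add.commute le_Suc_ex)
    have 1: "A powi (- int N + 2 * int p) = A ^ p / (A ^ r * A ^ m)"
    proof -
      have "- int N + 2 * int p = int p - int (r + m)" by (simp add: N)
      moreover have "A powi (int p - int (r + m)) = A powi int p / A powi int (r + m)"
        using A0 by (intro power_int_diff disjI1)
      ultimately show ?thesis by (simp only: power_int_of_nat power_add)
    qed
    have 2: "q powi (int m * (- int N + int p) + int (m choose 2)) = q ^ (m choose 2) / (q ^ (m * m) * (q ^ m) ^ r)"
    proof -
      have "int m * (- int N + int p) + int (m choose 2) = int (m choose 2) - int (m * m + m * r)"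
        by (simp add: N algebra_simps)
      moreover have "q powi (int (m choose 2) - int (m * m + m * r)) = q powi int (m choose 2) / q powi int (m * m + m * r)"
        using q0 by (intro power_int_diff disjI1)
      ultimately show ?thesis by (simp only: power_int_of_nat power_add power_mult)
    qed
    show "(- q) ^ m * q ^ (m choose 2) / (q ^ (m * m) * A ^ m) *
     (qbinom q (m + p) m * A ^ p * (qbinom q (m + (N - m - p)) m * (1 / (A * q ^ m)) ^ (N - m - p))) =
     (- q) ^ m * (A powi (- int N + 2 * int p) * qbinom q (m + p) m * qbinom q (N - p) m
     * q powi (int m * (- int N + int p) + int (m choose 2)))"
      unfolding 1 2
      by (simp add: N power_divide power_mult_distrib add.commute add.left_commute) (simp only: mult_ac)
  qed
  finally show ?thesis by (simp add: sum_distrib_left)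
qed

end

section \<open>Ballot numbers and the expansion of (2x)^n\<close>

definition ballot :: "nat \<Rightarrow> int \<Rightarrow> 'a::ring_1" where
  "ballot n s = of_nat (binom_int n s) - of_nat (binom_int n (s - 1))"

lemma ballot_Suc: "ballot (Suc n) s = ballot n s + ballot n (s - 1)"
proof -
  have *: "binom_int (Suc n) t = binom_int n t + binom_int n (t - 1)" for t
  proof (cases "t \<le> 0")
    case False
    then obtain k where "t = int (Suc k)"
      by (intro that[of "nat (t - 1)"]) simp
    then show ?thesis by (simp add: binom_int_def nat_add_distrib)
  qed (auto simp: binom_int_def)
  show ?thesis unfolding ballot_def * by simp
qed

text \<open>Here n = 2k + 1 and s = k + 1, so the two binomials are mirror images. The corresponding
  Chebyshev index is the exceptional one of \<open>cheb_U_int_rec\<close>.\<close>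

lemma ballot_mid: "int n - 2 * s = - 1 \<Longrightarrow> ballot n s = 0"
proof -
  assume h: "int n - 2 * s = - 1"
  then have "0 < s" by linarith
  then obtain k where k: "s = int (Suc k)"
    by (intro that[of "nat (s - 1)"]) simp
  with h have "n = Suc (2 * k)" by simp
  then show ?thesis using binomial_symmetric[of k n] by (simp add: ballot_def binom_int_def k nat_add_distrib)
qed

text \<open>With value 0 at negative indices the three-term recurrence fails only at k = -1, where
  its right-hand side is 1 instead of 0.\<close>

definition cheb_U_int :: "int \<Rightarrow> 'a::comm_ring_1 poly" where
  "cheb_U_int k = (if k < 0 then 0 else cheb_U (nat k))"

lemma cheb_U_int_rec:
  assumes "k \<noteq> - 1"
  shows "[:0, 2:] * cheb_U_int k = cheb_U_int (k + 1) + cheb_U_int (k - 1)"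
proof -
  consider "k < - 1" | "k = 0" | j where "k = int (Suc j)"
  proof -
    have "k = int (Suc (nat (k - 1)))" if "0 < k" using that by simp
    moreover have "k < - 1 \<or> k = 0 \<or> 0 < k" using assms by linarith
    ultimately show ?thesis using that by blast
  qed
  then show ?thesis
    by cases (simp_all add: cheb_U_int_def nat_add_distrib)
qed

text \<open>Multiplication by 2x splits each term into its two neighbours, and collecting them gives
  Pascal's rule for \<open>ballot\<close>. The index -1, where the splitting fails, has weight
  zero.\<close>

lemma two_x_power_cheb_U:
  "[:0, 2 :: 'a::comm_ring_1:] ^ n = (\<Sum>s = 0..n + 1. smult (ballot n (int s)) (cheb_U_int (int n - 2 * int s)))"
proof (induction n)
  case 0
  show ?case by (simp add: ballot_def binom_int_def cheb_U_int_def)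
next
  case (Suc n)
  let ?V = "\<lambda>s. cheb_U_int (int (Suc n) - 2 * int s) :: 'a poly"
  have step: "[:0, 2 :: 'a:] * smult (ballot n (int s)) (cheb_U_int (int n - 2 * int s)) =
      smult (ballot n (int s)) (?V s) + smult (ballot n (int s)) (?V (Suc s))" for s
  proof (cases "int n - 2 * int s = - 1")
    case True
    then show ?thesis by (simp add: ballot_mid)
  next
    case False
    show ?thesis unfolding mult_smult_right cheb_U_int_rec[OF False] smult_add_right
      by (intro arg_cong2[where f = "(+)"] arg_cong[where f = "smult _"] arg_cong[where f = cheb_U_int]) simp_all
  qed
  have "[:0, 2 :: 'a:] ^ Suc n = (\<Sum>s = 0..n + 1. smult (ballot n (int s)) (?V s)) + (\<Sum>s = 0..n + 1. smult (ballot n (int s)) (?V (Suc s)))"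
    unfolding power_Suc Suc.IH sum_distrib_left step sum.distrib ..
  \<comment> \<open>The added term s = n + 2 has a negative Chebyshev index.\<close>
  also have "(\<Sum>s = 0..n + 1. smult (ballot n (int s)) (?V s)) = (\<Sum>s = 0..Suc n + 1. smult (ballot n (int s)) (?V s))"
    by (simp add: cheb_U_int_def)
  \<comment> \<open>After the shift of s the extra term s = 0 carries \<open>ballot n (- 1)\<close>,
    which is zero.\<close>
  also have "(\<Sum>s = 0..n + 1. smult (ballot n (int s)) (?V (Suc s))) = (\<Sum>s = 0..Suc n + 1. smult (ballot n (int s - 1)) (?V s))"
  proof -
    have "ballot n (- 1 :: int) = (0 :: 'a)" by (simp add: ballot_def binom_int_def)
    then show ?thesis
      unfolding atLeast0AtMost add_Suc sum.atMost_Suc_shift by (simp add: algebra_simps)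
  qed
  finally show ?case
    by (simp only: ballot_Suc smult_add_left sum.distrib)
qed

section \<open>The Askey-Wilson functional on the basis \<open>\<phi>\<^sub>m(x;a)\<close>\<close>

lemma aw_functional_add: "aw_functional a b c d q (p + r) = aw_functional a b c d q p + aw_functional a b c d q r"
  and aw_functional_smult: "aw_functional a b c d q (smult u p) = u * aw_functional a b c d q p"
  and aw_functional_1: "aw_functional a b c d q 1 = 1"
  and aw_functional_aw_poly: "n \<ge> 1 \<Longrightarrow> aw_functional a b c d q (aw_poly a b c d q n) = 0"
  using is_aw_functional_aw_functional[of a b c d q]
  unfolding is_aw_functional_def linear_functional_iff by blast+

lemma aw_functional_0: "aw_functional a b c d q 0 = 0"
  using aw_functional_smult[of a b c d q 0 0] by simp

lemma aw_functional_diff: "aw_functional a b c d q (p - r) = aw_functional a b c d q p - aw_functional a b c d q r"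
  using aw_functional_add[of a b c d q "p - r" r] by simp

lemma aw_functional_sum: "aw_functional a b c d q (\<Sum>i\<in>I. f i) = (\<Sum>i\<in>I. aw_functional a b c d q (f i))"
  by (induction I rule: infinite_finite_induct) (simp_all add: aw_functional_add aw_functional_0)

lemma x_times_aw_poly:
  "[:0, 1:] * aw_poly a b c d q n = aw_poly a b c d q (Suc n) + smult (aw_b a b c d q n) (aw_poly a b c d q n)
     + (if n = 0 then 0 else smult (aw_lam a b c d q n) (aw_poly a b c d q (n - 1)))"
proof -
  have *: "[:- u, 1:] = [:0, 1:] - [:u:]" "[:u:] * p = smult u p" for u :: 'a and p by simp_all
  show ?thesis
    by (cases n) (simp_all only: aw_poly.simps * left_diff_distrib, simp_all)
qed

section \<open>Connection coefficients between \<phi>_k(x;a) and the Askey-Wilson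
  polynomials\<close>

text \<open>\<open>aw_coeff a b c d q k n\<close> is the coefficient of \<open>P\<^sub>n\<close> in \<open>\<phi>\<^sub>k(x;a)\<close>.\<close>

definition aw_coeff :: "'a::field \<Rightarrow> 'a \<Rightarrow> 'a \<Rightarrow> 'a \<Rightarrow> 'a \<Rightarrow> nat \<Rightarrow> nat \<Rightarrow> 'a" where
  "aw_coeff a b c d q k n = qbinom q k n * (- 2 * a) ^ n * q ^ (n choose 2)
     * (qpoch (a * b * q ^ n) q (k - n) * qpoch (a * c * q ^ n) q (k - n) * qpoch (a * d * q ^ n) q (k - n))
     / qpoch (a * b * c * d * q ^ (2 * n)) q (k - n)"

text \<open>This is \<open>aw_coeff_recurrence\<close> with the coefficient at (k, n+1) factored out
  and denominators cleared, for x = q^n and z = q^(k-n-1), so that X = q^(n+1) and K = q^k.\<close>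

lemma aw_coeff_rational_identity:
  fixes a b c d q x z :: "'a::field"
  shows
  "(let X = q * x; K = X * z; D = a * b * c * d in
     (1-q*K)*((1-a*b*K)*(1-a*c*K)*(1-a*d*K))*(1-D*x^2)*(1-D*x*X)*(1-D*X^2)
     + (a^2*K + K - (1 + a^2*K^2)) * (1-q*z)*(1-D*x^2)*(1-D*x*X)*(1-D*X^2)*(1-D*X*K)
     - K * ((1-a*b*X)*(1-a*c*X)*(1-a*d*X))*(1-D*x)*(1-q*z)*(1-D*x^2)*(1-D*X*K)
     - a^2*K*(1-X)*((1-b*c*x)*(1-b*d*x)*(1-c*d*x))*(1-q*z)*(1-D*X^2)*(1-D*X*K)
     - a^2*K*X*(1-z)*(1-D*x)*((1-b*c*X)*(1-b*d*X)*(1-c*d*X))*(1-q*z)*(1-D*x^2)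
     - q*z*(1-X)*((1-a*b*x)*(1-a*c*x)*(1-a*d*x))*(1-D*x*K)*(1-D*X^2)*(1-D*X*K)
     = 0)"
  unfolding Let_def by algebra

lemma six_term_fraction:
  fixes w1 w2 w3 w4 w5 :: "'a::field"
  assumes "w1 \<noteq> 0" "w2 \<noteq> 0" "w3 \<noteq> 0" "w4 \<noteq> 0" "w5 \<noteq> 0"
    and "N1 * w2 * w3 * w4 + M * w1 * w2 * w3 * w4 * w5 - N2 * w1 * w2 * w5 - N3 * w1 * w4 * w5
      - N4 * w1 * w2 - N5 * w4 * w5 = 0"
  shows "N1 / (w1 * w5) + M - N2 / (w3 * w4) - N3 / (w2 * w3) - N4 / (w3 * w4 * w5) - N5 / (w1 * w2 * w3) = 0"
proof -
  have "N1 / (w1 * w5) + M - N2 / (w3 * w4) - N3 / (w2 * w3) - N4 / (w3 * w4 * w5) - N5 / (w1 * w2 * w3) =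
    (N1 * w2 * w3 * w4 + M * w1 * w2 * w3 * w4 * w5 - N2 * w1 * w2 * w5 - N3 * w1 * w4 * w5
      - N4 * w1 * w2 - N5 * w4 * w5) / (w1 * w2 * w3 * w4 * w5)"
    using assms(1-5) by (simp add: add_divide_distrib diff_divide_distrib mult_ac)
  then show ?thesis using assms(6) by simp
qed

context
  fixes a b c d q :: "'a::field_char_0"
  assumes a0: "a \<noteq> 0" and q0: "q \<noteq> 0"
    and q_generic: "\<And>k::nat. k \<ge> 1 \<Longrightarrow> q ^ k \<noteq> 1"
    and abcd_generic: "\<And>k::nat. a * b * c * d * q ^ k \<noteq> 1"
begin

lemma abcd_nz: "1 - a * b * c * d * q ^ k \<noteq> 0"
  using abcd_generic[of k] by simp

lemma qpoch_abcd_nz: "qpoch (a * b * c * d * q ^ m) q n \<noteq> 0"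
  by (rule qpoch_nonzero) (use abcd_generic[of "m + _"] in \<open>simp add: power_add mult.assoc\<close>)

lemma aw_coeff_eq_0: "k < n \<Longrightarrow> aw_coeff a b c d q k n = 0"
  by (simp add: aw_coeff_def)

lemma aw_coeff_Suc_left:
  assumes "n \<le> k"
  shows "aw_coeff a b c d q (Suc k) n = aw_coeff a b c d q k n *
    ((1 - q ^ Suc k) * ((1 - a * b * q ^ k) * (1 - a * c * q ^ k) * (1 - a * d * q ^ k))
      / ((1 - q ^ Suc (k - n)) * (1 - a * b * c * d * q ^ (n + k))))"
proof -
  obtain r where k: "k = n + r" using assms le_Suc_ex by blast
  have 1: "qbinom q (Suc (n + r)) n = qbinom q (n + r) n * (1 - q ^ Suc (n + r)) / (1 - q ^ Suc r)"
    by (simp add: qbinom_def qpoch_Suc Suc_diff_le)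
  have 2: "qpoch (y * q ^ n) q (Suc r) = qpoch (y * q ^ n) q r * (1 - y * q ^ (n + r))" for y
    by (simp add: qpoch_Suc power_add mult.assoc)
  have 3: "qpoch (a * b * c * d * q ^ (2 * n)) q (Suc r) = qpoch (a * b * c * d * q ^ (2 * n)) q r * (1 - a * b * c * d * q ^ (n + (n + r)))"
    by (simp add: qpoch_Suc power_add mult.assoc mult_2)
  have 4: "Suc (n + r) - n = Suc r" "n + r - n = r" by simp_all
  show ?thesis
    unfolding aw_coeff_def k 4 1 2 3 by simp (simp only: mult_ac)
qed

text \<open>The factors 1 - abq^n, 1 - acq^n, 1 - adq^n stay on the left because they may vanish.
  For n = k both sides are zero.\<close>

lemma aw_coeff_Suc_right:
  assumes "n \<le> k"
  shows "aw_coeff a b c d q k (Suc n) *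
      ((1 - a * b * q ^ n) * (1 - a * c * q ^ n) * (1 - a * d * q ^ n))
    = aw_coeff a b c d q k n * (- 2 * a * q ^ n) * (1 - q ^ (k - n))
      * ((1 - a * b * c * d * q ^ (2 * n)) * (1 - a * b * c * d * q ^ (2 * n + 1)))
      / ((1 - q ^ Suc n) * (1 - a * b * c * d * q ^ (n + k)))"
proof (cases "n = k")
  case True
  then show ?thesis by (simp add: aw_coeff_eq_0)
next
  case False
  then obtain r where k: "k = Suc n + r" using assms by (metis Suc_leI le_Suc_ex nat_less_le)
  note nz = qpoch_q_nonzero[OF q_generic] one_minus_q_power[OF q_generic]
  have 1: "qbinom q k (Suc n) = qbinom q k n * (1 - q ^ Suc r) / (1 - q ^ Suc n)"
    using nz[of r] by (simp add: k qbinom_def qpoch_Suc Suc_diff_le)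
  have 2: "qpoch (y * q ^ n) q (Suc r) = (1 - y * q ^ n) * qpoch (y * q ^ Suc n) q r" for y
    unfolding qpoch_Suc_shift by (simp add: mult_ac)
  let ?D = "a * b * c * d"
  have "qpoch (?D * q ^ (2 * n)) q (Suc r) * (1 - ?D * q ^ (n + k)) = qpoch (?D * q ^ (2 * n)) q (Suc (Suc r))"
    by (simp add: k qpoch_Suc power_add mult.assoc mult_2)
  also have "\<dots> = (1 - ?D * q ^ (2 * n)) * (1 - ?D * q ^ (2 * n + 1)) * qpoch (?D * q ^ (2 * Suc n)) q r"
    unfolding qpoch_Suc_shift by (simp add: mult_ac)
  finally have 3: "(1 - ?D * q ^ (2 * n)) * (1 - ?D * q ^ (2 * n + 1)) * qpoch (?D * q ^ (2 * Suc n)) q r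
     = qpoch (?D * q ^ (2 * n)) q (Suc r) * (1 - ?D * q ^ (n + k))" ..
  have 5: "(1 - ?D * q ^ (2 * n)) * (1 - ?D * q ^ (2 * n + 1)) / (1 - ?D * q ^ (n + k)) =
     qpoch (?D * q ^ (2 * n)) q (Suc r) / qpoch (?D * q ^ (2 * Suc n)) q r"
    using 3 qpoch_abcd_nz abcd_nz by (simp add: frac_eq_eq mult_ac del: mult_Suc_right power_Suc)
  have 4: "k - Suc n = r" "k - n = Suc r" by (simp_all add: k)
  have "aw_coeff a b c d q k n * (- 2 * a * q ^ n) * (1 - q ^ (k - n))
      * ((1 - ?D * q ^ (2 * n)) * (1 - ?D * q ^ (2 * n + 1)))
      / ((1 - q ^ Suc n) * (1 - ?D * q ^ (n + k)))
    = aw_coeff a b c d q k n * (- 2 * a * q ^ n) * (1 - q ^ Suc r) / (1 - q ^ Suc n)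
      * (qpoch (?D * q ^ (2 * n)) q (Suc r) / qpoch (?D * q ^ (2 * Suc n)) q r)"
    unfolding 5[symmetric] 4 by simp
  also have "\<dots> = aw_coeff a b c d q k (Suc n) * ((1 - a * b * q ^ n) * (1 - a * c * q ^ n) * (1 - a * d * q ^ n))"
    unfolding aw_coeff_def 1 4 2 choose_two_Suc
    using qpoch_abcd_nz[of "2 * n" "Suc r"]
    by (simp add: power_add mult_ac del: mult_Suc_right power_Suc) (simp add: mult_ac)
  finally show ?thesis ..
qed

text \<open>A_n inside \<lambda>_(n+1) supplies exactly the product on the left of
  \<open>aw_coeff_Suc_right\<close>. The separate value at n = 0 reflects the cancelled factor in
  A_0.\<close>

lemma lam_times_aw_coeff:
  assumes "n \<le> k"
  shows "aw_lam a b c d q (Suc n) * aw_coeff a b c d q k (Suc n) = - a / 2 * q ^ n * (1 - q ^ (k - n))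
     * ((1 - b * c * q ^ n) * (1 - b * d * q ^ n) * (1 - c * d * q ^ n))
     * (if n = 0 then 1 / (1 - a * b * c * d)
        else (1 - a * b * c * d * q ^ (n - 1)) / ((1 - a * b * c * d * q ^ (2 * n - 1)) * (1 - a * b * c * d * q ^ (2 * n))))
     / (1 - a * b * c * d * q ^ (n + k)) * aw_coeff a b c d q k n"
proof -
  let ?D = "a * b * c * d"
  let ?F = "if n = 0 then 1 / (1 - a * b * c * d)
        else (1 - ?D * q ^ (n - 1)) / ((1 - ?D * q ^ (2 * n - 1)) * (1 - ?D * q ^ (2 * n)))"
  let ?\<Pi> = "(1 - a * b * q ^ n) * (1 - a * c * q ^ n) * (1 - a * d * q ^ n)"
  have 1: "aw_A a b c d q n = ?\<Pi> * ?F / a"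
    using a0 by (simp add: aw_A_def)
  have 2: "aw_C a b c d q (Suc n) = a * (1 - q ^ Suc n) * ((1 - b * c * q ^ n) * (1 - b * d * q ^ n) * (1 - c * d * q ^ n))
           / ((1 - ?D * q ^ (2 * n)) * (1 - ?D * q ^ (2 * n + 1)))"
    by (simp add: aw_C_def mult.assoc)
  have "aw_lam a b c d q (Suc n) * aw_coeff a b c d q k (Suc n) = 1 / 4 * ?F / a * aw_C a b c d q (Suc n) * (aw_coeff a b c d q k (Suc n) * ?\<Pi>)"
    unfolding aw_lam_def diff_Suc_1 1 by (simp only: mult_ac times_divide_eq_left times_divide_eq_right)
  also have "\<dots> = 1 / 4 * ?F / a * (- 2 * a * q ^ n) * (1 - q ^ (k - n)) * a
     * ((1 - b * c * q ^ n) * (1 - b * d * q ^ n) * (1 - c * d * q ^ n))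
     / (1 - ?D * q ^ (n + k)) * aw_coeff a b c d q k n"
    unfolding aw_coeff_Suc_right[OF assms] 2
    using one_minus_q_power[OF q_generic, of n] abcd_nz[of "2 * n"] abcd_nz[of "2 * n + 1"]
    by (simp add: divide_simps) 
  finally show ?thesis using a0 by simp
qed

lemma aw_coeff_recurrence_0:
  "aw_coeff a b c d q (Suc k) 0 = (1 + a\<^sup>2 * q ^ (2 * k)) * aw_coeff a b c d q k 0
     - 2 * a * q ^ k * (aw_lam a b c d q 1 * aw_coeff a b c d q k 1 + aw_b a b c d q 0 * aw_coeff a b c d q k 0)"
proof -
  let ?D = "a * b * c * d"
  define K where "K = q ^ k"
  define e where "e = aw_coeff a b c d q k 0"
  have nz: "1 - ?D \<noteq> 0" "1 - ?D * K \<noteq> 0" "1 - q * K \<noteq> 0"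
    using abcd_nz[of 0] abcd_nz[of k] one_minus_q_power[OF q_generic, of k] by (simp_all add: K_def)
  have 1: "aw_coeff a b c d q (Suc k) 0 = e * (((1 - a * b * K) * (1 - a * c * K) * (1 - a * d * K)) / (1 - ?D * K))"
    using aw_coeff_Suc_left[of 0 k] nz(3) by (simp add: e_def K_def)
  have 2: "aw_lam a b c d q 1 * aw_coeff a b c d q k 1 = - a / 2 * (1 - K) *
     ((1 - b * c) * (1 - b * d) * (1 - c * d)) / (1 - ?D) / (1 - ?D * K) * e"
    using lam_times_aw_coeff[of 0 k] by (simp add: e_def K_def)
  have 3: "aw_b a b c d q 0 = (a + 1 / a - (1 - a * b) * (1 - a * c) * (1 - a * d) / (a * (1 - ?D))) / 2"
    by (simp add: aw_b_def aw_A_def aw_C_def inverse_eq_divide)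
  have 4: "q ^ (2 * k) = K\<^sup>2" by (simp add: K_def power_mult mult.commute)
  have 5: "(1 - a * b * K) * (1 - a * c * K) * (1 - a * d * K) / w2 = (1 + a\<^sup>2 * K\<^sup>2)
     - 2 * a * K * (- a / 2 * (1 - K) * ((1 - b * c) * (1 - b * d) * (1 - c * d)) / w1 / w2 +
       (a + 1 / a - (1 - a * b) * (1 - a * c) * (1 - a * d) / (a * w1)) / 2)"
    if "w1 = 1 - ?D" "w2 = 1 - ?D * K" "w1 \<noteq> 0" "w2 \<noteq> 0" for w1 w2
  proof -
    have *: "(1 - a * b * K) * (1 - a * c * K) * (1 - a * d * K) * w1 = (1 + a\<^sup>2 * K\<^sup>2) * w1 * w2
     + a ^ 2 * K * (1 - K) * ((1 - b * c) * (1 - b * d) * (1 - c * d)) -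
       (a^2 + 1) * K * w1 * w2 + K * (1 - a * b) * (1 - a * c) * (1 - a * d) * w2"
      unfolding that(1,2) by algebra
    have "(1 - a * b * K) * (1 - a * c * K) * (1 - a * d * K) / w2 = ((1 + a\<^sup>2 * K\<^sup>2) * w1 * w2
     + a ^ 2 * K * (1 - K) * ((1 - b * c) * (1 - b * d) * (1 - c * d)) -
       (a^2 + 1) * K * w1 * w2 + K * (1 - a * b) * (1 - a * c) * (1 - a * d) * w2) / (w1 * w2)"
      unfolding *[symmetric] using that(3,4) by simp
    also have "\<dots> = (1 + a\<^sup>2 * K\<^sup>2)
     - 2 * a * K * (- a / 2 * (1 - K) * ((1 - b * c) * (1 - b * d) * (1 - c * d)) / w1 / w2 +
       (a + 1 / a - (1 - a * b) * (1 - a * c) * (1 - a * d) / (a * w1)) / 2)"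
      using that(3,4) a0 
      by (simp add: add_divide_distrib diff_divide_distrib distrib_left right_diff_distrib power2_eq_square mult_ac)
    finally show ?thesis .
  qed
  show ?thesis
    unfolding 1 2 3 4 5[OF refl refl nz(1,2)] K_def[symmetric] e_def[symmetric] by algebra
qed

text \<open>This is the comparison of coefficients of P_(n+1) in \<phi>_(k+1) = (1 + a^2q^(2k) -
  2aq^k x) \<phi>_k, with x P_j expanded by the three-term recurrence. It is checked on the explicit
  formula.\<close>

lemma aw_coeff_recurrence:
  "aw_coeff a b c d q (Suc k) (Suc n) = (1 + a\<^sup>2 * q ^ (2 * k)) * aw_coeff a b c d q k (Suc n)
     - 2 * a * q ^ k * (aw_lam a b c d q (Suc (Suc n)) * aw_coeff a b c d q k (Suc (Suc n))
        + aw_b a b c d q (Suc n) * aw_coeff a b c d q k (Suc n) + aw_coeff a b c d q k n)"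
proof -
  consider "Suc n \<le> k" | "n = k" | "k < n" by linarith
  then show ?thesis
  proof cases
    \<comment> \<open>Only the two diagonal coefficients, at (k+1, k+1) and (k, k), survive.\<close>
    case 2
    then show ?thesis by (simp add: aw_coeff_eq_0) (simp add: aw_coeff_def qbinom_self[OF q_generic] choose_two_Suc power_add)
  next
    case 3
    then show ?thesis by (simp add: aw_coeff_eq_0)
  next
    case 1
    let ?D = "a * b * c * d"
    obtain r where k: "k = Suc n + r" using 1 le_Suc_ex by blast
    define e x z X K where "e = aw_coeff a b c d q k (Suc n)" and "x = q ^ n" and "z = q ^ r"
      and "X = q * x" and "K = X * z"
    have pows: "q ^ k = K" "q ^ Suc n = X" "q ^ Suc k = q * K" "q ^ Suc (k - Suc n) = q * z" "q ^ (k - Suc n) = z" "q ^ (k - n) = q * z"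
      "q ^ (2 * k) = K\<^sup>2" "q ^ (2 * Suc n) = X\<^sup>2" "q ^ (2 * Suc n - 1) = x * X" "q ^ (2 * n) = x\<^sup>2" "q ^ (2 * n + 1) = x * X"
      "q ^ (Suc n + k) = X * K" "q ^ (n + k) = x * K" "q ^ n = x" "q ^ (2 * Suc n - 2) = x\<^sup>2"
      by (simp_all add: x_def X_def z_def power_add power2_eq_square mult_2 mult_2_right K_def k Suc_diff_le mult_ac)
    have nz: "1 - q * z \<noteq> 0" "1 - ?D * x\<^sup>2 \<noteq> 0" "1 - ?D * (x * X) \<noteq> 0" "1 - ?D * X\<^sup>2 \<noteq> 0" "1 - ?D * (X * K) \<noteq> 0"
      "1 - ?D * (x * K) \<noteq> 0" "1 - X \<noteq> 0" "x \<noteq> 0"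
      using abcd_nz[of "2 * n"] abcd_nz[of "2 * n + 1"] abcd_nz[of "2 * Suc n"] abcd_nz[of "Suc n + k"] abcd_nz[of "n + k"]
        one_minus_q_power[OF q_generic, of n] one_minus_q_power[OF q_generic, of r] q0
      unfolding pows by (simp_all add: z_def x_def X_def)
    obtain w1 w2 w3 w4 w5 where w: "w1 = 1 - q * z" "w2 = 1 - ?D * x\<^sup>2" "w3 = 1 - ?D * (x * X)" "w4 = 1 - ?D * X\<^sup>2"
      "w5 = 1 - ?D * (X * K)" by blast
    note wnz = nz(1-5)[folded w]
    obtain PK PX Px QX Qx D1 D2 where P: "PK = (1 - a * b * K) * (1 - a * c * K) * (1 - a * d * K)"
      "PX = (1 - a * b * X) * (1 - a * c * X) * (1 - a * d * X)"
      "Px = (1 - a * b * x) * (1 - a * c * x) * (1 - a * d * x)"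
      "QX = (1 - b * c * X) * (1 - b * d * X) * (1 - c * d * X)"
      "Qx = (1 - b * c * x) * (1 - b * d * x) * (1 - c * d * x)"
      "D1 = 1 - ?D * x" "D2 = 1 - ?D * (x * K)" by blast
    have 2: "aw_coeff a b c d q (Suc k) (Suc n) = e * ((1 - q * K) * PK / (w1 * w5))"
      using aw_coeff_Suc_left[OF 1] unfolding pows e_def[symmetric] w P .
    have 3: "2 * a * K * (aw_lam a b c d q (Suc (Suc n)) * aw_coeff a b c d q k (Suc (Suc n))) =
        - (a\<^sup>2 * K * X * (1 - z) * D1 * QX / (w3 * w4 * w5)) * e"
    proof -
      have "2 * a * K * (- a / 2 * X * y * QX * (D1 / v) / w5 * e) = - (a\<^sup>2 * K * X * y * D1 * QX / (v * w5)) * e" for y v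
        by (simp add: power2_eq_square mult_ac)
      then show ?thesis
        unfolding lam_times_aw_coeff[OF 1] diff_Suc_1 pows if_not_P[OF Suc_not_Zero] e_def[symmetric] P(4,6)[symmetric] w[symmetric] .
    qed
    have 4: "2 * a * K * (aw_b a b c d q (Suc n) * e) =
       (a\<^sup>2 * K + K - K * PX * D1 / (w3 * w4) - a\<^sup>2 * K * (1 - X) * Qx / (w2 * w3)) * e"
    proof -
      have A: "aw_A a b c d q (Suc n) = PX * D1 / (a * (w3 * w4))"
        unfolding aw_A_def diff_Suc_1 pows if_not_P[OF Suc_not_Zero] w P by (simp only: mult.assoc)
      have C: "aw_C a b c d q (Suc n) = a * (1 - X) * Qx / (w2 * w3)"
        unfolding aw_C_def diff_Suc_1 pows if_not_P[OF Suc_not_Zero] w P by (simp only: mult.assoc)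
      have gen: "2 * a * K * (1 / 2 * (a + inverse a - (PX * D1 / (a * u) + a * (1 - X) * Qx / v))) =
         a\<^sup>2 * K + K - K * PX * D1 / u - a\<^sup>2 * K * (1 - X) * Qx / v" for u v
        using a0 by (simp add: algebra_simps power2_eq_square)
      have "2 * a * K * aw_b a b c d q (Suc n) =
          a\<^sup>2 * K + K - K * PX * D1 / (w3 * w4) - a\<^sup>2 * K * (1 - X) * Qx / (w2 * w3)"
        unfolding aw_b_def A C by (rule gen)
      then show ?thesis by (simp only: mult.assoc[symmetric])
    qed
    \<comment> \<open>\<open>aw_coeff_Suc_right\<close> is read backwards, which puts
      \<open>Px\<close> into the numerator.\<close>
    have 5: "2 * a * K * aw_coeff a b c d q k n = - (q * z * (1 - X) * Px * D2 / (w1 * w2 * w3)) * e"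
    proof -
      have "e * Px = aw_coeff a b c d q k n * (- 2 * a * x) * w1 * (w2 * w3) / ((1 - X) * D2)"
        using aw_coeff_Suc_right[of n k] 1 unfolding pows e_def[symmetric] w P by simp
      then have h: "e * Px * ((1 - X) * D2) = aw_coeff a b c d q k n * (- 2 * a * x) * w1 * (w2 * w3)"
        using nz(6,7) unfolding P by (simp add: eq_divide_eq)
      have "- (q * z * (1 - X) * Px * D2 / (w1 * w2 * w3)) * e = - (q * z * (e * Px * ((1 - X) * D2))) / (w1 * w2 * w3)"
        by (simp add: mult_ac)
      also have "\<dots> = 2 * a * K * aw_coeff a b c d q k n"
        unfolding h using wnz by (simp add: K_def X_def mult_ac)
      finally show ?thesis ..
    qed
    have "(1 - q * K) * PK / (w1 * w5) + (a\<^sup>2 * K + K - (1 + a\<^sup>2 * K\<^sup>2)) - K * PX * D1 / (w3 * w4)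
       - a\<^sup>2 * K * (1 - X) * Qx / (w2 * w3) - a\<^sup>2 * K * X * (1 - z) * D1 * QX / (w3 * w4 * w5)
       - q * z * (1 - X) * Px * D2 / (w1 * w2 * w3) = 0"
      using wnz
    proof (rule six_term_fraction)
      show "(1 - q * K) * PK * w2 * w3 * w4 + (a\<^sup>2 * K + K - (1 + a\<^sup>2 * K\<^sup>2)) * w1 * w2 * w3 * w4 * w5
       - K * PX * D1 * w1 * w2 * w5 - a\<^sup>2 * K * (1 - X) * Qx * w1 * w4 * w5
       - a\<^sup>2 * K * X * (1 - z) * D1 * QX * w1 * w2 - q * z * (1 - X) * Px * D2 * w4 * w5 = 0"
        using aw_coeff_rational_identity[of q x z a b c d]
        unfolding w P Let_def K_def X_def by (simp only: mult.assoc)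
    qed
    then show ?thesis
      unfolding distrib_left 2 3 4 5 pows e_def[symmetric] by algebra
  qed
qed

text \<open>Only n = 0 is wanted, but in the induction on k the factor x moves onto P_n and brings
  in both neighbours. With the product of the \<lambda>'s as normalization the resulting recurrence
  is that of \<open>aw_coeff\<close>.\<close>

lemma aw_functional_basis_times_poly:
  "aw_functional a b c d q (aw_basis a q k * aw_poly a b c d q n) =
     aw_coeff a b c d q k n * (\<Prod>i<n. aw_lam a b c d q (Suc i))"
proof (induction k arbitrary: n)
  case 0
  show ?case
  proof (cases n)
    case 0
    then show ?thesis by (simp add: aw_functional_1 aw_coeff_def qbinom_self[OF q_generic] binomial_eq_0)
  next
    case (Suc n')
    then show ?thesis by (simp add: aw_functional_aw_poly aw_coeff_eq_0 del: aw_poly.simps)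
  qed
next
  case (Suc k)
  let ?L = "aw_functional a b c d q" and ?P = "aw_poly a b c d q" and ?\<phi> = "aw_basis a q k"
  have "aw_basis a q (Suc k) * ?P n =
      smult (1 + a\<^sup>2 * q ^ (2 * k)) (?\<phi> * ?P n) - smult (2 * a * q ^ k) (?\<phi> * ([:0, 1:] * ?P n))"
  proof -
    have *: "[:1 + a\<^sup>2 * q ^ (2 * k), - 2 * a * q ^ k:] = [:1 + a\<^sup>2 * q ^ (2 * k):] - smult (2 * a * q ^ k) [:0, 1:]"
      by simp
    have **: "[:u:] * p = smult u p" for u :: 'a and p by simp
    show ?thesis
      unfolding aw_basis_Suc * unfolding mult.assoc left_diff_distrib ** mult_smult_left mult_smult_right
      by (simp only: mult.left_commute)
  qed
  then have rec: "?L (aw_basis a q (Suc k) * ?P n) = (1 + a\<^sup>2 * q ^ (2 * k)) * ?L (?\<phi> * ?P n)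
      - 2 * a * q ^ k * (?L (?\<phi> * ?P (Suc n)) + aw_b a b c d q n * ?L (?\<phi> * ?P n)
          + (if n = 0 then 0 else aw_lam a b c d q n * ?L (?\<phi> * ?P (n - 1))))"
    unfolding x_times_aw_poly
    by (simp add: aw_functional_add aw_functional_diff aw_functional_smult aw_functional_0 distrib_left del: aw_poly.simps)
  show ?case
  proof (cases n)
    case 0
    show ?thesis unfolding rec Suc.IH unfolding 0
      by (simp add: aw_coeff_recurrence_0[unfolded One_nat_def] algebra_simps)
  next
    case (Suc n')
    show ?thesis unfolding rec Suc.IH unfolding Suc aw_coeff_recurrence
      by (simp add: algebra_simps)
  qed
qed

lemma aw_functional_basis:
  "aw_functional a b c d q (aw_basis a q k) =
     qpoch (a * b) q k * qpoch (a * c) q k * qpoch (a * d) q k / qpoch (a * b * c * d) q k"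
  using aw_functional_basis_times_poly[of k 0]
  by (simp add: aw_coeff_def qbinom_0[OF q_generic] binomial_eq_0)

end

section \<open>Multiplication by 1 - 2ax + a^2 as the shift from a to aq\<close>

context
  fixes a b c d q :: "'a::field_char_0"
  assumes a0: "a \<noteq> 0" and q0: "q \<noteq> 0"
    and q_generic: "\<And>k::nat. k \<ge> 1 \<Longrightarrow> q ^ k \<noteq> 1"
    and abcd_generic: "\<And>k::nat. a * b * c * d * q ^ k \<noteq> 1"
begin

text \<open>
  Both sides agree on the polynomials \<open>aw_basis (a * q) q k\<close>, which span everything; the induction
  over \<open>p\<close> uses that multiplication by \<open>x\<close> maps such a polynomial to a combination of two of them.
\<close>

lemma aw_functional_shift:
  "aw_functional a b c d q ([:1 + a\<^sup>2, - 2 * a:] * p) =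
     (1 - a * b) * (1 - a * c) * (1 - a * d) / (1 - a * b * c * d) * aw_functional (a * q) b c d q p"
proof -
  let ?L = "aw_functional a b c d q" and ?L' = "aw_functional (a * q) b c d q" and ?\<phi> = "aw_basis (a * q) q"
  let ?w = "[:1 + a\<^sup>2, - 2 * a:]"
  define K where "K = (1 - a * b) * (1 - a * c) * (1 - a * d) / (1 - a * b * c * d)"
  have "?L (?w * (?\<phi> k * p)) = K * ?L' (?\<phi> k * p)" for k
  proof (induction p arbitrary: k)
    case 0
    show ?case by (simp add: aw_functional_0)
  next
    case (pCons u p)
    have gen': "a * q * b * c * d * q ^ k \<noteq> 1" for k :: nat
      using abcd_generic[of "Suc k"] by (simp add: mult_ac)
    have aq0: "a * q \<noteq> 0" using a0 q0 by simp
    have base': "?L' (?\<phi> k) = qpoch (a * q * b) q k * qpoch (a * q * c) q k * qpoch (a * q * d) q k / qpoch (a * q * b * c * d) q k"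
      by (rule aw_functional_basis[OF aq0 q0 q_generic gen'])
    have base'': "?L (aw_basis a q (Suc k)) =
        qpoch (a * b) q (Suc k) * qpoch (a * c) q (Suc k) * qpoch (a * d) q (Suc k) / qpoch (a * b * c * d) q (Suc k)"
      by (rule aw_functional_basis[OF a0 q0 q_generic abcd_generic])
    \<comment> \<open>The weight is the missing first factor of \<open>aw_basis a q (Suc k)\<close>,
      so \<open>aw_functional_basis\<close> evaluates both sides, for a and for aq.\<close>
    have base: "?L (?w * ?\<phi> k) = K * ?L' (?\<phi> k)"
      unfolding aw_basis_Suc_shift[symmetric] base'' base' qpoch_Suc_shift K_def
      by (simp add: mult_ac)
    define \<mu> \<nu> where "\<mu> = a * q * q ^ k + 1 / (a * q * q ^ k)" and "\<nu> = 1 / (a * q * q ^ k)"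
    have x: "smult 2 (pCons 0 p * ?\<phi> k) = smult \<mu> (?\<phi> k * p) - smult \<nu> (?\<phi> (Suc k) * p)"
    proof -
      have "smult 2 (pCons 0 p * ?\<phi> k) = ([:0, 2:] * ?\<phi> k) * p" by (simp add: mult_ac)
      then show ?thesis
        unfolding aw_basis_mult_x[OF q0 aq0] \<mu>_def \<nu>_def by (simp only: left_diff_distrib mult_smult_left)
    qed
    have "2 * ?L (?w * (?\<phi> k * pCons 0 p)) = ?L (?w * smult 2 (pCons 0 p * ?\<phi> k))"
      by (simp only: mult_smult_left mult_smult_right aw_functional_smult mult_ac)
    also have "\<dots> = \<mu> * ?L (?w * (?\<phi> k * p)) - \<nu> * ?L (?w * (?\<phi> (Suc k) * p))"
      unfolding x by (simp only: right_diff_distrib mult_smult_right aw_functional_diff aw_functional_smult)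
    also have "\<dots> = K * (\<mu> * ?L' (?\<phi> k * p) - \<nu> * ?L' (?\<phi> (Suc k) * p))"
      unfolding pCons.IH by (simp only: right_diff_distrib mult_ac)
    also have "\<mu> * ?L' (?\<phi> k * p) - \<nu> * ?L' (?\<phi> (Suc k) * p) = ?L' (smult 2 (pCons 0 p * ?\<phi> k))"
      unfolding x by (simp only: aw_functional_diff aw_functional_smult)
    also have "\<dots> = 2 * ?L' (?\<phi> k * pCons 0 p)"
      by (simp only: aw_functional_smult mult_ac)
    finally have x_step: "?L (?w * (?\<phi> k * pCons 0 p)) = K * ?L' (?\<phi> k * pCons 0 p)"
      by simp
    have split: "?\<phi> k * pCons u p = smult u (?\<phi> k) + ?\<phi> k * pCons 0 p"
      by simp
    show ?case
      unfolding split distrib_left mult_smult_right aw_functional_add aw_functional_smult base x_step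
      by (simp only: mult_ac)
  qed
  from this[of 0] show ?thesis by (simp add: K_def)
qed

text \<open>With Y = Aq^m one has a(1 - 2xY + Y^2) = Y(1 - 2ax + a^2) + (a - Y)(1 - aY); the weight
  1 - 2ax + a^2 is then removed by \<open>aw_functional_shift\<close>.\<close>

lemma aw_functional_basis_recurrence:
  "a * aw_functional a b c d q (aw_basis A q (Suc m)) =
     A * q ^ m * ((1 - a * b) * (1 - a * c) * (1 - a * d) / (1 - a * b * c * d))
       * aw_functional (a * q) b c d q (aw_basis A q m)
     + (a - A * q ^ m) * (1 - a * A * q ^ m) * aw_functional a b c d q (aw_basis A q m)"
proof -
  let ?L = "aw_functional a b c d q" and ?\<phi> = "aw_basis A q"
  have "smult a [:1 + A\<^sup>2 * q ^ (2 * m), - 2 * A * q ^ m:] =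
     smult (A * q ^ m) [:1 + a\<^sup>2, - 2 * a:] + [:(a - A * q ^ m) * (1 - a * A * q ^ m):]"
    unfolding power_even_eq by (simp add: algebra_simps power2_eq_square)
  then have "smult a (?\<phi> (Suc m)) =
     smult (A * q ^ m) ([:1 + a\<^sup>2, - 2 * a:] * ?\<phi> m) + smult ((a - A * q ^ m) * (1 - a * A * q ^ m)) (?\<phi> m)"
    unfolding aw_basis_Suc mult_smult_left[symmetric]
    by (simp only: distrib_right mult_smult_left[symmetric]) simp
  then have "?L (smult a (?\<phi> (Suc m))) =
     A * q ^ m * ?L ([:1 + a\<^sup>2, - 2 * a:] * ?\<phi> m) + (a - A * q ^ m) * (1 - a * A * q ^ m) * ?L (?\<phi> m)"
    by (simp only: aw_functional_add aw_functional_smult)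
  then show ?thesis
    unfolding aw_functional_smult aw_functional_shift by (simp only: mult.assoc)
qed

end

section \<open>The very-well-poised sum\<close>

lemma qpoch_add: "qpoch x q (m + n) = qpoch x q m * qpoch (x * q ^ m) q n"
  by (induction n) (simp_all add: qpoch_Suc power_add mult_ac)

text \<open>This is (q^-m;q)_j q^(mj) / (q;q)_j without negative powers of q; see
  \<open>qpoch_inverse_power\<close>.\<close>

definition vwp_coeff :: "'a::field \<Rightarrow> nat \<Rightarrow> nat \<Rightarrow> 'a" where
  "vwp_coeff q m j = qbinom q m j * (- 1) ^ j * q ^ (j choose 2)"

text \<open>For j \<le> m and x nonzero this is x^j (A/x;q)_j (xAq^j;q)_(m-j), made polynomial in x
  by one share of (abcd)^j.\<close>

definition vwp_factor :: "'a::field \<Rightarrow> 'a \<Rightarrow> nat \<Rightarrow> nat \<Rightarrow> 'a \<Rightarrow> 'a" where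
  "vwp_factor A q m j x = (\<Prod>i<j. x - A * q ^ i) * qpoch (x * A * q ^ j) q (m - j)"

text \<open>
  \<open>vwp_sum\<close> is \<open>(aA,bA,cA,dA;q)\<^sub>m W(m) / (A\<^sup>2;q)\<^sub>m\<close>, written so that each summand is a product of
  one polynomial in each of \<open>a\<close>, \<open>b\<close>, \<open>c\<close>, \<open>d\<close>.
\<close>

definition vwp_sum :: "'a::field \<Rightarrow> 'a \<Rightarrow> 'a \<Rightarrow> 'a \<Rightarrow> 'a \<Rightarrow> 'a \<Rightarrow> nat \<Rightarrow> 'a" where
  "vwp_sum A a b c d q m = (\<Sum>j\<le>m.
     (1 - A\<^sup>2 / q * q ^ (2 * j)) / qpoch (A\<^sup>2 / q * q ^ j) q (Suc m) * vwp_coeff q m j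
     * (vwp_factor A q m j a * vwp_factor A q m j b * vwp_factor A q m j c * vwp_factor A q m j d))"

text \<open>Core of \<open>vwp_telescope\<close> at j = 0, with M = q^m.\<close>

lemma vwp_identity_0:
  fixes a b c d A M :: "'a::field"
  shows "(let Y = A * M; P = 1 - A^2 * M in
     a * (1 - a*A) * ((1 - b*Y) * (1 - c*Y) * (1 - d*Y)) - Y * P * ((1 - a*b) * (1 - a*c) * (1 - a*d))
     - (1 - a*b*c*d*M) * (a - Y) * (1 - a*A) * P
     = a * M * (a - Y) * ((b - A) * (c - A) * (d - A)))"
  unfolding Let_def by algebra

text \<open>Core of \<open>vwp_telescope\<close> at j = i + 1, with J = q^i and Z = q^(m-i). The
  products in s and r on the right come from the certificate at j + 1 and at j.\<close>

lemma vwp_identity_Suc: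
  fixes a b c d q A J Z :: "'a::field"
  shows "(let r = A*J; s = A*J*q; Y = A*J*Z; p = 1 - A^2*J; P = 1 - A^2*J*q*(J*Z) in
   a*(1-r*s)*(1-J*Z*q)*(a-r)*(1-a*s)*((1-b*Y)*(1-c*Y)*(1-d*Y))
   - (1-Z) * Y*(1-r*s)*P*J*(a*q-A)*((1-a*b)*(1-a*c)*(1-a*d))
   - (1-Z)*(a-Y)*(a-r)*(1-a*s)*(1-r*s)*P*(1-a*b*c*d*(J*Z))
   = (1-Z)*a*(J*Z)*(a-Y)*(a-r)*p*((b-s)*(c-s)*(d-s))
    + a * Z * (a-Y)*(1-a*s)*P*(1-J*q)*((1-b*r)*(1-c*r)*(1-d*r)))"
  unfolding Let_def by algebra

section \<open>Certificate and recurrence for the very-well-poised sum\<close>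

context
  fixes q A :: "'a::field_char_0"
  assumes q0: "q \<noteq> 0" and A0: "A \<noteq> 0"
    and q_generic: "\<And>k::nat. k \<ge> 1 \<Longrightarrow> q ^ k \<noteq> 1"
    and A2q: "A\<^sup>2 \<noteq> q" and A2: "\<And>k::nat. A\<^sup>2 * q ^ k \<noteq> 1"
begin

lemma A2_div_q_nz: "1 - A\<^sup>2 / q * q ^ k \<noteq> 0"
  using A2q A2[of "k - 1"] q0 by (cases k) (auto simp: field_simps)

lemma qpoch_A2_nz: "qpoch (A\<^sup>2 / q * q ^ m) q n \<noteq> 0"
  by (rule qpoch_nonzero) (use A2_div_q_nz[of "m + _"] in \<open>simp add: power_add mult.assoc\<close>)

text \<open>
  After division by the common factor of the \<open>j\<close>-th summands, the recurrence for \<open>vwp_sum\<close> involves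
  only products of the form \<open>(1 - by)(1 - cy)(1 - dy)\<close> and \<open>1 - abcdq\<^sup>m\<close>. These lie in the
  four-dimensional space spanned by the elementary symmetric polynomials of \<open>b\<close>, \<open>c\<close>, \<open>d\<close>, and
  solving the resulting linear system for the two unknown multiples of \<open>(b - Aq\<^sup>j)(c - Aq\<^sup>j)(d - Aq\<^sup>j)\<close> and
  \<open>(1 - bAq\<^bsup>j-1\<^esup>)(1 - cAq\<^bsup>j-1\<^esup>)(1 - dAq\<^bsup>j-1\<^esup>)\<close> yields the certificate.
\<close>

definition vwp_cert :: "'a \<Rightarrow> 'a \<Rightarrow> 'a \<Rightarrow> 'a \<Rightarrow> nat \<Rightarrow> nat \<Rightarrow> 'a" where
  "vwp_cert a b c d m j = (case j of 0 \<Rightarrow> 0 | Suc i \<Rightarrow>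
     a * q ^ m * (a - A * q ^ m) * ((\<Prod>l<i. a - A * q ^ l) * qpoch (a * A * q ^ Suc i) q (m - i))
     * vwp_coeff q m i / qpoch (A\<^sup>2 / q * q ^ Suc i) q (Suc m)
     * ((vwp_factor A q m i b * (b - A * q ^ i)) * (vwp_factor A q m i c * (c - A * q ^ i)) * (vwp_factor A q m i d * (d - A * q ^ i))))"

text \<open>All terms are multiples of \<open>B\<close>, since raising m appends only 1 - xAq^m to
  each factor \<open>vwp_factor\<close>. What remains is \<open>vwp_identity_0\<close> or
  \<open>vwp_identity_Suc\<close>.\<close>

lemma vwp_telescope:
  assumes "j \<le> m"
  shows "a * ((1 - A\<^sup>2 / q * q ^ (2 * j)) / qpoch (A\<^sup>2 / q * q ^ j) q (Suc (Suc m)) * vwp_coeff q (Suc m) j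
     * (vwp_factor A q (Suc m) j a * vwp_factor A q (Suc m) j b * vwp_factor A q (Suc m) j c * vwp_factor A q (Suc m) j d))
   - A * q ^ m * ((1 - a * b) * (1 - a * c) * (1 - a * d)) *
     ((1 - A\<^sup>2 / q * q ^ (2 * j)) / qpoch (A\<^sup>2 / q * q ^ j) q (Suc m) * vwp_coeff q m j
     * (vwp_factor A q m j (a * q) * vwp_factor A q m j b * vwp_factor A q m j c * vwp_factor A q m j d))
   - (1 - a * b * c * d * q ^ m) * ((a - A * q ^ m) * (1 - a * A * q ^ m)) *
     ((1 - A\<^sup>2 / q * q ^ (2 * j)) / qpoch (A\<^sup>2 / q * q ^ j) q (Suc m) * vwp_coeff q m j
     * (vwp_factor A q m j a * vwp_factor A q m j b * vwp_factor A q m j c * vwp_factor A q m j d))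
   = vwp_cert a b c d m (Suc j) - vwp_cert a b c d m j"
proof -
  define E where "E = qpoch (A\<^sup>2 / q * q ^ j) q (Suc (Suc m))"
  define P p where "P = 1 - A\<^sup>2 / q * q ^ (j + Suc m)" and "p = 1 - A\<^sup>2 / q * q ^ j"
  have nz: "E \<noteq> 0" "P \<noteq> 0" "p \<noteq> 0"
    unfolding E_def P_def p_def by (rule qpoch_A2_nz A2_div_q_nz)+
  have E1: "qpoch (A\<^sup>2 / q * q ^ j) q (Suc m) = E / P"
    using nz by (simp add: E_def P_def qpoch_Suc[of _ _ "Suc m"] power_add mult.assoc)
  have E2: "qpoch (A\<^sup>2 / q * q ^ Suc j) q (Suc m) = E / p"
    using nz by (simp add: E_def p_def qpoch_Suc_shift[of _ _ "Suc m"] mult_ac)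
  define Y where "Y = A * q ^ m"
  define Ub Uc Ud where "Ub = vwp_factor A q m j b" and "Uc = vwp_factor A q m j c" and "Ud = vwp_factor A q m j d"
  have U: "vwp_factor A q (Suc m) j x = vwp_factor A q m j x * (1 - x * Y)" for x
    using assms by (simp add: vwp_factor_def Suc_diff_le qpoch_Suc Y_def mult.assoc flip: power_add)
  have aY: "a * A * q ^ m = a * Y" by (simp add: Y_def)
  define B where "B = Ub * Uc * Ud / E"
  show ?thesis
  proof (cases j)
    case 0
    define Qa where "Qa = qpoch (a * q * A) q m"
    have ua: "vwp_factor A q m j a * (1 - a * Y) = (1 - a * A) * Qa"
      using qpoch_Suc[of "a * A" q m] qpoch_Suc_shift[of "a * A" q m]
      by (simp add: vwp_factor_def 0 Qa_def Y_def mult_ac)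
    have uaq: "vwp_factor A q m j (a * q) = Qa" by (simp add: vwp_factor_def 0 Qa_def)
    have G: "vwp_cert a b c d m (Suc j) = a * q ^ m * (a - Y) * Qa * p * B * ((b - A) * (c - A) * (d - A))"
      unfolding vwp_cert_def by (simp add: E2[unfolded 0, simplified] 0 Qa_def Y_def vwp_coeff_def qbinom_0[OF q_generic] binomial_eq_0 B_def Ub_def Uc_def Ud_def mult_ac)
    have G0: "vwp_cert a b c d m j = 0" by (simp add: vwp_cert_def 0)
    have c: "vwp_coeff q m' j = 1" for m' by (simp add: vwp_coeff_def 0 qbinom_0[OF q_generic] binomial_eq_0)
    have pP: "1 - A\<^sup>2 / q * q ^ (2 * j) = p" "P = 1 - A\<^sup>2 * q ^ m" using q0 by (simp_all add: p_def P_def 0)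
    have "a * (p * B * (((1 - a * A) * Qa) * (1 - b * Y) * (1 - c * Y) * (1 - d * Y)))
      - Y * ((1 - a * b) * (1 - a * c) * (1 - a * d)) * (p * P * B * Qa)
      - (1 - a * b * c * d * q ^ m) * (a - Y) * (p * P * B * ((1 - a * A) * Qa))
      = a * q ^ m * (a - Y) * Qa * p * B * ((b - A) * (c - A) * (d - A))"
      (is "?l = ?r")
    proof -
      have "a * (1 - a * A) * ((1 - b * Y) * (1 - c * Y) * (1 - d * Y))
          - Y * P * ((1 - a * b) * (1 - a * c) * (1 - a * d)) - (1 - a * b * c * d * q ^ m) * (a - Y) * (1 - a * A) * P
        = a * q ^ m * (a - Y) * ((b - A) * (c - A) * (d - A))" (is "?l' = ?r'")
        using vwp_identity_0[where a=a and b=b and c=c and d=d and A=A and M="q ^ m"]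
        unfolding Let_def Y_def[symmetric] pP(2)[symmetric] .
      moreover have "?l - ?r = p * B * Qa * (?l' - ?r')" by algebra
      ultimately show ?thesis by simp
    qed
    then show ?thesis
      unfolding G G0 diff_0_right E_def[symmetric] E1 U pP(1) c uaq aY Y_def[symmetric] ua[symmetric]
        Ub_def[symmetric] Uc_def[symmetric] Ud_def[symmetric] B_def
      using nz by (simp add: mult_ac)
  next
    case (Suc i)
    then obtain r where m: "m = Suc i + r" using assms le_Suc_ex by blast
    define J Z where "J = q ^ i" and "Z = q ^ Suc r"
    have pows: "q ^ m = J * Z" "Y = A * J * Z" "q ^ j = J * q"
      by (simp_all add: J_def Z_def m Suc power_add Y_def mult_ac)
    define r' s' where "r' = A * J" and "s' = A * J * q"
    define Pa Qa where "Pa = (\<Prod>l<i. a - A * q ^ l)" and "Qa = qpoch (a * A * q ^ Suc j) q r"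
    have mj: "m - j = r" "m - i = Suc r" by (simp_all add: m Suc)
    have qa: "qpoch (a * A * q ^ j) q (Suc r) = (1 - a * s') * Qa"
      unfolding qpoch_Suc_shift Qa_def s'_def pows power_Suc by (simp add: mult_ac)
    have "qpoch (a * A * q ^ j) q (Suc r) = qpoch (a * A * q ^ j) q r * (1 - a * Y)"
      by (simp add: qpoch_Suc Y_def m Suc power_add mult_ac)
    then have ua: "vwp_factor A q m j a * (1 - a * Y) = Pa * Qa * (a - r') * (1 - a * s')"
      using qa mj(1) by (simp add: vwp_factor_def Suc Pa_def r'_def J_def mult_ac)
    \<comment> \<open>All factors except the first release one q each, leaving \<open>Pa\<close>
      times q^i.\<close>
    have "(\<Prod>l<j. a * q - A * q ^ l) = (a * q - A) * (J * Pa)"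
    proof -
      have "(\<Prod>l<i. a * q - A * q ^ Suc l) = (\<Prod>l<i. q * (a - A * q ^ l))"
        by (intro prod.cong) (simp_all add: algebra_simps)
      then show ?thesis
        unfolding Suc prod.lessThan_Suc_shift J_def Pa_def by (simp add: prod.distrib)
    qed
    then have uaq: "vwp_factor A q m j (a * q) = Pa * Qa * (J * (a * q - A))"
      by (simp add: vwp_factor_def mj Qa_def mult_ac)
    define C where "C = vwp_coeff q m j"
    have nzZ: "1 - Z \<noteq> 0" using one_minus_q_power[OF q_generic, of r] by (simp add: Z_def)
    have J0: "J \<noteq> 0" using q0 by (simp add: J_def)
    note nzq = qpoch_q_nonzero[OF q_generic]
    have C1: "vwp_coeff q (Suc m) j = C * (1 - J * Z * q) / (1 - Z)"
    proof -
      have "qbinom q (Suc m) j = qbinom q m j * (1 - J * Z * q) / (1 - Z)"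
        using assms nzq[of r] nzZ
        by (simp add: qbinom_def Suc_diff_le mj qpoch_Suc Z_def pows(1) mult_ac)
      then show ?thesis by (simp add: vwp_coeff_def C_def)
    qed
    have C2: "vwp_coeff q m i = - C * (1 - J * q) / (J * (1 - Z))"
    proof -
      have "qbinom q m i = qbinom q m j * (1 - J * q) / (1 - Z)"
        using assms nzq[of r] nzq[of i] nzZ one_minus_q_power[OF q_generic, of i]
        by (simp add: qbinom_def mj Suc m qpoch_Suc Z_def J_def mult_ac)
      then show ?thesis using q0 nzZ by (simp add: vwp_coeff_def C_def Suc choose_two_Suc power_add J_def)
    qed
    have v: "vwp_factor A q m i x * (x - A * q ^ i) = vwp_factor A q m j x * (1 - x * r')" for x
      unfolding vwp_factor_def mj qpoch_Suc_shift Suc r'_def J_def by (simp add: mj(1)[unfolded Suc] mult_ac)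
    have sJ: "A * q ^ j = s'" by (simp add: s'_def pows(3) mult_ac)
    have G1: "vwp_cert a b c d m (Suc j) = a * (J * Z) * (a - Y) * (Pa * Qa * (a - r')) * C * p * B
       * ((b - s') * (c - s') * (d - s'))"
      unfolding vwp_cert_def nat.case E2 mj
      unfolding Suc[symmetric] sJ pows(1) C_def[symmetric]
      using Suc by (simp add: pows(2) Qa_def Pa_def r'_def J_def B_def Ub_def Uc_def Ud_def mult_ac)
    have G2: "vwp_cert a b c d m j = - (a * Z * (a - Y) * (Pa * Qa * (1 - a * s')) * (C * (1 - J * q) / (1 - Z)) * P * B
       * ((1 - b * r') * (1 - c * r') * (1 - d * r')))"
      unfolding Suc vwp_cert_def nat.case v
      unfolding Suc[symmetric] E1 mj qa Pa_def[symmetric] C2 pows(1)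
      using J0 by (simp add: pows(2) B_def Ub_def Uc_def Ud_def mult_ac)
    have pP: "1 - A\<^sup>2 / q * q ^ (2 * j) = 1 - r' * s'" "p = 1 - A\<^sup>2 * J" "P = 1 - A\<^sup>2 * J * q * (J * Z)"
      using q0 by (simp_all add: p_def P_def power_add pows r'_def s'_def mult_2 mult_2_right power2_eq_square mult_ac)
    have main: "a * ((1 - r' * s') * (C * (1 - J * Z * q) / (1 - Z)) * B
        * (Pa * Qa * (a - r') * (1 - a * s')) * ((1 - b * Y) * (1 - c * Y) * (1 - d * Y)))
      - Y * ((1 - a * b) * (1 - a * c) * (1 - a * d)) * ((1 - r' * s') * C * P * B * (Pa * Qa * (J * (a * q - A))))
      - (1 - a * b * c * d * (J * Z)) * (a - Y) * ((1 - r' * s') * C * P * B * (Pa * Qa * (a - r') * (1 - a * s')))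
      = a * (J * Z) * (a - Y) * (Pa * Qa * (a - r')) * C * p * B * ((b - s') * (c - s') * (d - s'))
       + a * Z * (a - Y) * (Pa * Qa * (1 - a * s')) * (C * (1 - J * q) / (1 - Z)) * P * B
       * ((1 - b * r') * (1 - c * r') * (1 - d * r'))" (is "?l = ?r")
    proof -
      \<comment> \<open>Absorbing the division by \<open>1 - Z\<close> leaves a polynomial
        identity.\<close>
      define C' where "C' = C / (1 - Z)"
      have C: "C = C' * (1 - Z)" and C': "C * x / (1 - Z) = C' * x" for x
        using nzZ by (simp_all add: C'_def)
      have "a*(1-r'*s')*(1-J*Z*q)*(a-r')*(1-a*s')*((1-b*Y)*(1-c*Y)*(1-d*Y))
          - (1-Z)*Y*(1-r'*s')*P*J*(a*q-A)*((1-a*b)*(1-a*c)*(1-a*d))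
          - (1-Z)*(a-Y)*(a-r')*(1-a*s')*(1-r'*s')*P*(1-a*b*c*d*(J*Z))
        = (1-Z)*a*(J*Z)*(a-Y)*(a-r')*p*((b-s')*(c-s')*(d-s'))
          + a*Z*(a-Y)*(1-a*s')*P*(1-J*q)*((1-b*r')*(1-c*r')*(1-d*r'))" (is "?l' = ?r'")
        using vwp_identity_Suc[where a=a and b=b and c=c and d=d and A=A and q=q and J=J and Z=Z]
        unfolding Let_def pP(2,3)[symmetric] s'_def[symmetric] pows(2)[symmetric]
        unfolding r'_def[symmetric] .
      moreover have "?l - ?r = C' * B * Pa * Qa * (?l' - ?r')"
        unfolding C' unfolding C by algebra
      ultimately show ?thesis by simp
    qed
    show ?thesis
      using main nz
      unfolding G1 G2 E_def[symmetric] E1 U pP(1) C1 C_def[symmetric] uaq aY Y_def[symmetric] ua[symmetric] pows(1)[symmetric]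
        Ub_def[symmetric] Uc_def[symmetric] Ud_def[symmetric] B_def
      by (simp add: mult_ac)
  qed
qed

text \<open>Summing \<open>vwp_telescope\<close> over j \<le> m leaves the certificate at m + 1, its
  value at 0 being 0. The summand j = m + 1, present on the left only, cancels it.\<close>

lemma vwp_sum_Suc:
  "a * vwp_sum A a b c d q (Suc m) = A * q ^ m * ((1 - a * b) * (1 - a * c) * (1 - a * d)) * vwp_sum A (a * q) b c d q m
     + (1 - a * b * c * d * q ^ m) * ((a - A * q ^ m) * (1 - a * A * q ^ m)) * vwp_sum A a b c d q m"
proof -
  let ?W = "\<lambda>m a j. (1 - A\<^sup>2 / q * q ^ (2 * j)) / qpoch (A\<^sup>2 / q * q ^ j) q (Suc m) * vwp_coeff q m j
     * (vwp_factor A q m j a * vwp_factor A q m j b * vwp_factor A q m j c * vwp_factor A q m j d)"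
  let ?k = "A * q ^ m * ((1 - a * b) * (1 - a * c) * (1 - a * d))"
    and ?l = "(1 - a * b * c * d * q ^ m) * ((a - A * q ^ m) * (1 - a * A * q ^ m))"
  have last: "a * ?W (Suc m) a (Suc m) = - vwp_cert a b c d m (Suc m)"
  proof -
    have "qpoch (A\<^sup>2 / q * q ^ Suc m) q (Suc (Suc m)) = qpoch (A\<^sup>2 / q * q ^ Suc m) q (Suc m) * (1 - A\<^sup>2 / q * q ^ (2 * Suc m))"
      unfolding qpoch_Suc[of _ _ "Suc m"] by (simp add: mult_2 mult_2_right power_add mult_ac)
    then have 1: "(1 - A\<^sup>2 / q * q ^ (2 * Suc m)) / qpoch (A\<^sup>2 / q * q ^ Suc m) q (Suc (Suc m)) = 1 / qpoch (A\<^sup>2 / q * q ^ Suc m) q (Suc m)"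
      using A2_div_q_nz[of "2 * Suc m"] by (simp del: power_Suc mult_Suc_right)
    have 2: "vwp_coeff q (Suc m) (Suc m) = - (q ^ m * vwp_coeff q m m)"
      by (simp add: vwp_coeff_def qbinom_self[OF q_generic] choose_two_Suc power_add)
    show ?thesis
      unfolding 1 2 vwp_cert_def nat.case vwp_factor_def diff_self_eq_0 qpoch_0 prod.lessThan_Suc
      by (simp del: power_Suc add: mult_ac)
  qed
  have "(\<Sum>j\<le>m. a * ?W (Suc m) a j - ?k * ?W m (a * q) j - ?l * ?W m a j)
      = (\<Sum>j\<le>m. vwp_cert a b c d m (Suc j) - vwp_cert a b c d m j)"
    by (rule sum.cong[OF refl], rule vwp_telescope) simp
  also have "\<dots> = vwp_cert a b c d m (Suc m)"
    using sum_lessThan_telescope[of "vwp_cert a b c d m" "Suc m"]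
    by (simp add: lessThan_Suc_atMost vwp_cert_def)
  finally have "a * (\<Sum>j\<le>m. ?W (Suc m) a j) - ?k * vwp_sum A (a * q) b c d q m - ?l * vwp_sum A a b c d q m
     = vwp_cert a b c d m (Suc m)"
    unfolding vwp_sum_def sum_subtractf sum_distrib_left .
  moreover have "a * vwp_sum A a b c d q (Suc m) = a * (\<Sum>j\<le>m. ?W (Suc m) a j) + a * ?W (Suc m) a (Suc m)"
    unfolding vwp_sum_def sum.atMost_Suc distrib_left ..
  moreover have "w = y + z" if "x - y - z = g" "w = x + - g" for w x y z g :: 'a
    using that by (simp add: algebra_simps)
  ultimately show ?thesis
    unfolding last by blast
qed

text \<open>Both sides obey the same recurrence in m. It involves aq besides a, so the induction
  keeps a arbitrary.\<close>

lemma aw_functional_basis_vwp: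
  assumes "a \<noteq> 0" and "\<And>k::nat. a * b * c * d * q ^ k \<noteq> 1"
  shows "aw_functional a b c d q (aw_basis A q m) = vwp_sum A a b c d q m / qpoch (a * b * c * d) q m"
  using assms
proof (induction m arbitrary: a)
  case 0
  have "vwp_sum A a b c d q 0 = 1"
    using A2_div_q_nz[of 0]
    by (simp add: vwp_sum_def vwp_coeff_def vwp_factor_def qpoch_Suc qbinom_0[OF q_generic] binomial_eq_0)
  then show ?case by (simp add: aw_functional_1)
next
  case (Suc m)
  let ?D = "a * b * c * d"
  have gen': "a * q * b * c * d * q ^ k \<noteq> 1" for k :: nat
    using Suc.prems(2)[of "Suc k"] by (simp add: mult_ac)
  have aq0: "a * q \<noteq> 0" using Suc.prems(1) q0 by simp
  have nz: "qpoch ?D q k \<noteq> 0" for k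
    by (rule qpoch_nonzero) (rule Suc.prems(2))
  have D: "(1 - ?D) * qpoch (a * q * b * c * d) q m = qpoch ?D q (Suc m)"
    unfolding qpoch_Suc_shift by (simp add: mult_ac)
  have D': "qpoch ?D q (Suc m) = qpoch ?D q m * (1 - ?D * q ^ m)"
    by (rule qpoch_Suc)
  have "1 - ?D * q ^ m \<noteq> 0" using Suc.prems(2)[of m] by simp
  then have D'': "1 / qpoch ?D q m = (1 - ?D * q ^ m) / qpoch ?D q (Suc m)"
    unfolding D' by simp
  have "a * aw_functional a b c d q (aw_basis A q (Suc m)) =
      A * q ^ m * ((1 - a * b) * (1 - a * c) * (1 - a * d)) * vwp_sum A (a * q) b c d q m / ((1 - ?D) * qpoch (a * q * b * c * d) q m)
      + (a - A * q ^ m) * (1 - a * A * q ^ m) * vwp_sum A a b c d q m * (1 / qpoch ?D q m)"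
    using aw_functional_basis_recurrence[OF Suc.prems(1) q0 q_generic Suc.prems(2), of A m]
    unfolding Suc.IH[OF Suc.prems] Suc.IH[OF aq0 gen'] by simp
  also have "\<dots> = a * vwp_sum A a b c d q (Suc m) / qpoch ?D q (Suc m)"
    unfolding D D'' vwp_sum_Suc by (simp add: add_divide_distrib mult_ac)
  finally show ?case
    using Suc.prems(1) by (simp only: times_divide_eq_right[symmetric] mult_cancel_left) simp
qed

section \<open>Translation into the series \<open>W87\<close>\<close>

text \<open>Factor by factor, (1 - q^(i-m)) q^m = -q^i (1 - q^(m-i)).\<close>

lemma qpoch_inverse_power:
  assumes "j \<le> m"
  shows "qpoch (q powi (- int m)) q j * (q ^ m) ^ j = vwp_coeff q m j * qpoch q q j"
proof -
  have "qpoch (q powi (- int m)) q j * (q ^ m) ^ j = (\<Prod>i<j. (1 - q powi (- int m) * q ^ i) * q ^ m)"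
    by (simp add: qpoch_def prod.distrib)
  also have "\<dots> = (\<Prod>i<j. - (q ^ i) * (1 - q ^ (m - i)))"
  proof (rule prod.cong[OF refl])
    fix i assume "i \<in> {..<j}"
    then have "q ^ i * q ^ (m - i) = q ^ m" using assms by (simp flip: power_add)
    then show "(1 - q powi (- int m) * q ^ i) * q ^ m = - (q ^ i) * (1 - q ^ (m - i))"
      using q0 by (simp add: power_int_minus algebra_simps)
  qed
  also have "\<dots> = (- 1) ^ j * q ^ (j choose 2) * (qpoch q q m / qpoch q q (m - j))"
    using assms
  proof (induction j)
    case 0
    show ?case using qpoch_q_nonzero[OF q_generic] by (simp add: binomial_eq_0)
  next
    case (Suc j)
    have mj: "m - j = Suc (m - Suc j)" using Suc.prems by simp
    have "qpoch q q (m - j) = qpoch q q (m - Suc j) * (1 - q ^ (m - j))"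
      unfolding mj qpoch_Suc by simp
    then have *: "1 / qpoch q q (m - Suc j) = (1 - q ^ (m - j)) / qpoch q q (m - j)"
      using qpoch_q_nonzero[OF q_generic, of "m - j"] by auto
    have "qpoch q q m / qpoch q q (m - Suc j) = qpoch q q m * ((1 - q ^ (m - j)) / qpoch q q (m - j))"
      unfolding *[symmetric] by simp
    then show ?case using Suc by (simp add: choose_two_Suc power_add mult_ac)
  qed
  also have "\<dots> = vwp_coeff q m j * qpoch q q j"
    using assms qpoch_q_nonzero[OF q_generic, of j] by (simp add: vwp_coeff_def qbinom_def)
  finally show ?thesis .
qed

lemma qpoch_quotient_eq_vwp_factor:
  assumes "j \<le> m" "x \<noteq> 0" "\<And>k::nat. x * A * q ^ k \<noteq> 1"
  shows "qpoch (x * A) q m * (qpoch (A / x) q j / qpoch (A\<^sup>2 / q * q / (A / x)) q j * x ^ j) = vwp_factor A q m j x"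
proof -
  have 1: "A\<^sup>2 / q * q / (A / x) = x * A" using q0 A0 by (simp add: power2_eq_square)
  have 2: "qpoch (A / x) q j * x ^ j = (\<Prod>i<j. x - A * q ^ i)"
  proof -
    have "qpoch (A / x) q j * x ^ j = (\<Prod>i<j. (1 - A / x * q ^ i) * x)"
      by (simp add: qpoch_def prod.distrib)
    also have "\<dots> = (\<Prod>i<j. x - A * q ^ i)"
      using assms(2) by (intro prod.cong) (simp_all add: left_diff_distrib)
    finally show ?thesis .
  qed
  have 3: "qpoch (x * A) q m = qpoch (x * A) q j * qpoch (x * A * q ^ j) q (m - j)"
    using qpoch_add[of "x * A" q j "m - j"] assms(1) by simp
  have "qpoch (x * A) q j \<noteq> 0" by (rule qpoch_nonzero) (rule assms(3))
  then show ?thesis unfolding 1 vwp_factor_def 2[symmetric] 3 by simp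
qed

text \<open>Termwise, (abcdq^m)^j gives a power x^j to each of the four parameters x and q^(mj) to
  the terminating symbol.\<close>

lemma vwp_sum_eq_W87:
  assumes "a \<noteq> 0" "b \<noteq> 0" "c \<noteq> 0" "d \<noteq> 0"
    and "\<And>k::nat. a * A * q ^ k \<noteq> 1" "\<And>k::nat. b * A * q ^ k \<noteq> 1"
      "\<And>k::nat. c * A * q ^ k \<noteq> 1" "\<And>k::nat. d * A * q ^ k \<noteq> 1"
  shows "vwp_sum A a b c d q m = qpochs [a * A, b * A, c * A, d * A] q m / qpoch (A\<^sup>2) q m
    * W87 (A\<^sup>2 / q) (A / a) (A / b) (A / c) (A / d) (q powi (- int m)) q (a * b * c * d * q ^ m)"
  unfolding W87_terminating[OF q0] sum_distrib_left vwp_sum_def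
proof (rule sum.cong[OF refl])
  fix j assume "j \<in> {..m}"
  then have j: "j \<le> m" by simp
  let ?\<alpha> = "A\<^sup>2 / q"
  note U = qpoch_quotient_eq_vwp_factor[OF j]
  have A2m: "?\<alpha> * q / q powi (- int m) = A\<^sup>2 * q ^ m"
    using q0 by (simp add: power_int_minus divide_inverse)
  \<comment> \<open>Both sides come from (A^2/q;q)_(m+j+1), cut after j factors or after 1 and m + 1
    factors.\<close>
  have w: "1 / qpoch (?\<alpha> * q ^ j) q (Suc m) = 1 / qpoch (A\<^sup>2) q m * (1 / (1 - ?\<alpha>)) * (qpoch ?\<alpha> q j / qpoch (A\<^sup>2 * q ^ m) q j)"
  proof -
    have "qpoch ?\<alpha> q j * qpoch (?\<alpha> * q ^ j) q (Suc m) = qpoch ?\<alpha> q (Suc (m + j))"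
      using qpoch_add[of ?\<alpha> q j "Suc m"] by (simp add: add.commute)
    also have "\<dots> = (1 - ?\<alpha>) * (qpoch (A\<^sup>2) q m * qpoch (A\<^sup>2 * q ^ m) q j)"
      unfolding qpoch_Suc_shift qpoch_add using q0 by simp
    finally have *: "qpoch ?\<alpha> q j * qpoch (?\<alpha> * q ^ j) q (Suc m) = (1 - ?\<alpha>) * (qpoch (A\<^sup>2) q m * qpoch (A\<^sup>2 * q ^ m) q j)" .
    have nz: "qpoch (?\<alpha> * q ^ j) q (Suc m) \<noteq> 0" "qpoch ?\<alpha> q j \<noteq> 0"
      using qpoch_A2_nz[of j "Suc m"] qpoch_A2_nz[of 0 j] by simp_all
    then have "(1 - ?\<alpha>) * (qpoch (A\<^sup>2) q m * qpoch (A\<^sup>2 * q ^ m) q j) \<noteq> 0"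
      unfolding *[symmetric] by simp
    then have "1 / qpoch (?\<alpha> * q ^ j) q (Suc m) = qpoch ?\<alpha> q j / ((1 - ?\<alpha>) * (qpoch (A\<^sup>2) q m * qpoch (A\<^sup>2 * q ^ m) q j))"
      unfolding *[symmetric] using nz by simp
    then show ?thesis by simp
  qed
  have v: "vwp_coeff q m j = qpoch (q powi (- int m)) q j / qpoch q q j * (q ^ m) ^ j"
    using qpoch_inverse_power[OF j] qpoch_q_nonzero[OF q_generic, of j] by (simp add: field_simps)
  have "(1 - ?\<alpha> * q ^ (2 * j)) / qpoch (?\<alpha> * q ^ j) q (Suc m) = (1 - ?\<alpha> * q ^ (2 * j)) * (1 / qpoch (?\<alpha> * q ^ j) q (Suc m))"
    by simp
  then show "(1 - ?\<alpha> * q ^ (2 * j)) / qpoch (?\<alpha> * q ^ j) q (Suc m) * vwp_coeff q m j *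
       (vwp_factor A q m j a * vwp_factor A q m j b * vwp_factor A q m j c * vwp_factor A q m j d) =
       qpochs [a * A, b * A, c * A, d * A] q m / qpoch (A\<^sup>2) q m *
       ((1 - ?\<alpha> * q ^ (2 * j)) / (1 - ?\<alpha>)
        * (qpochs [?\<alpha>, A / a, A / b, A / c, A / d, q powi (- int m)] q j
          / qpochs [q, ?\<alpha> * q / (A / a), ?\<alpha> * q / (A / b), ?\<alpha> * q / (A / c), ?\<alpha> * q / (A / d),
                    ?\<alpha> * q / q powi (- int m)] q j)
        * (a * b * c * d * q ^ m) ^ j)"
    unfolding U[OF assms(1,5), symmetric] U[OF assms(2,6), symmetric] U[OF assms(3,7), symmetric]
      U[OF assms(4,8), symmetric] w v A2m
    by (simp only: qpochs_def list.map prod_list.Cons prod_list.Nil power_mult_distrib mult_ac mult_1_right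
        times_divide_eq_left times_divide_eq_right divide_divide_eq_left mult_1)
qed

section \<open>Assembling the moment formula\<close>

text \<open>The range of m is extended to n for every s, which allows the sums over m and s to be
  exchanged later. Surplus inner sums are empty, as are all of them for 2s > n.\<close>

lemma aw_functional_cheb_U_int:
  assumes "a \<noteq> 0" and "\<And>k::nat. a * b * c * d * q ^ k \<noteq> 1"
  shows "aw_functional a b c d q (cheb_U_int (int n - 2 * int s)) =
    (\<Sum>m = 0..n. vwp_sum A a b c d q m / qpoch (a * b * c * d) q m * (- q) ^ m *
       (\<Sum>p \<in> {p::nat. int p \<le> int n - 2 * int s - int m}.
                 A powi (- int n + 2 * int s + 2 * int p)
                 * qbinom q (m + p) m * qbinom q (n - 2 * s - p) m
                 * q powi (int m * (- int n + 2 * int s + int p) + int (m choose 2))))"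
proof (cases "2 * s \<le> n")
  case False
  then have "{p::nat. int p \<le> int n - 2 * int s - int m} = {}" for m by auto
  then show ?thesis using False by (simp add: cheb_U_int_def aw_functional_0)
next
  case True
  define N where "N = n - 2 * s"
  have N: "int n - 2 * int s = int N" "N \<le> n" using True by (simp_all add: N_def)
  have N': "- int n + 2 * int s = - int N" using N(1) by simp
  have "aw_functional a b c d q (cheb_U_int (int n - 2 * int s)) =
     (\<Sum>m\<le>n. cheb_fps q A m $ N * aw_functional a b c d q (aw_basis A q m))"
    unfolding N(1) cheb_U_int_def
    by (simp add: cheb_U_expansion[OF q_generic q0 A0 N(2)] aw_functional_sum aw_functional_smult)
  also have "\<dots> = (\<Sum>m\<le>n. vwp_sum A a b c d q m / qpoch (a * b * c * d) q m * (- q) ^ m *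
       (\<Sum>p \<in> {p::nat. int p \<le> int n - 2 * int s - int m}.
                 A powi (- int n + 2 * int s + 2 * int p)
                 * qbinom q (m + p) m * qbinom q (n - 2 * s - p) m
                 * q powi (int m * (- int n + 2 * int s + int p) + int (m choose 2))))"
  proof (rule sum.cong[OF refl])
    fix m
    have "cheb_fps q A m $ N = (- q) ^ m * (\<Sum>p \<in> {p::nat. int p \<le> int n - 2 * int s - int m}.
                 A powi (- int n + 2 * int s + 2 * int p)
                 * qbinom q (m + p) m * qbinom q (n - 2 * s - p) m
                 * q powi (int m * (- int n + 2 * int s + int p) + int (m choose 2)))"
    proof (cases "m \<le> N")
      case True
      then have "{p::nat. int p \<le> int N - int m} = {..N - m}" by auto
      then show ?thesis
        unfolding N(1) N' N_def[symmetric] by (simp only: cheb_fps_nth[OF q_generic q0 A0 True])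
    next
      case False
      then have "{p::nat. int p \<le> int N - int m} = {}" by auto
      then show ?thesis using False unfolding N(1) by (simp add: cheb_fps_nth_0[OF q_generic q0 A0])
    qed
    then show "cheb_fps q A m $ N * aw_functional a b c d q (aw_basis A q m) =
       vwp_sum A a b c d q m / qpoch (a * b * c * d) q m * (- q) ^ m *
       (\<Sum>p \<in> {p::nat. int p \<le> int n - 2 * int s - int m}.
                 A powi (- int n + 2 * int s + 2 * int p)
                 * qbinom q (m + p) m * qbinom q (n - 2 * s - p) m
                 * q powi (int m * (- int n + 2 * int s + int p) + int (m choose 2)))"
      unfolding aw_functional_basis_vwp[OF assms] by (simp only: mult_ac)
  qed
  finally show ?thesis by (simp only: atLeast0AtMost)
qed

end

theorem theorem2p10:
  fixes a b c d q A :: "'a::field_char_0" and n :: nat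
  assumes nonzero: "a \<noteq> 0" "b \<noteq> 0" "c \<noteq> 0" "d \<noteq> 0" "q \<noteq> 0" "A \<noteq> 0"
    and q_generic: "\<And>k::nat. k \<ge> 1 \<Longrightarrow> q ^ k \<noteq> 1"
    and abcd_generic: "\<And>k::nat. a * b * c * d * q ^ k \<noteq> 1"
    and A_generic: "A\<^sup>2 \<noteq> q" "\<And>k::nat. A\<^sup>2 * q ^ k \<noteq> 1"
      "\<And>k::nat. a * A * q ^ k \<noteq> 1" "\<And>k::nat. b * A * q ^ k \<noteq> 1"
      "\<And>k::nat. c * A * q ^ k \<noteq> 1" "\<And>k::nat. d * A * q ^ k \<noteq> 1"
  shows "2 ^ n * aw_moment a b c d q n =
    (\<Sum>m = 0..n.
       qpochs [a * A, b * A, c * A, d * A] q m / qpochs [A\<^sup>2, a * b * c * d] q m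
       * (- q) ^ m
       * W87 (A\<^sup>2 / q) (A / a) (A / b) (A / c) (A / d) (q powi (- int m)) q (a * b * c * d * q ^ m)
       * (\<Sum>s = 0..n + 1.
            (of_nat (binom_int n (int s)) - of_nat (binom_int n (int s - 1)))
            * (\<Sum>p \<in> {p::nat. int p \<le> int n - 2 * int s - int m}.
                 A powi (- int n + 2 * int s + 2 * int p)
                 * qbinom q (m + p) m * qbinom q (n - 2 * s - p) m
                 * q powi (int m * (- int n + 2 * int s + int p) + int (m choose 2)))))"
    (is "_ = (\<Sum>m = 0..n. ?C m * _ * ?W m * (\<Sum>s = 0..n + 1. _ * ?I s m))")
proof -
  let ?L = "aw_functional a b c d q"
  have x: "[:0, 2:] ^ n = smult (2 ^ n) ([:0, 1 :: 'a:] ^ n)"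
    by (simp flip: smult_power)
  have M: "vwp_sum A a b c d q m / qpoch (a * b * c * d) q m = ?C m * ?W m" for m
  proof -
    have "vwp_sum A a b c d q m = qpochs [a * A, b * A, c * A, d * A] q m / qpoch (A\<^sup>2) q m * ?W m"
      by (rule vwp_sum_eq_W87[OF nonzero(5,6) q_generic A_generic(1,2) nonzero(1-4) A_generic(3-6)])
    then show ?thesis by (simp add: qpochs_def)
  qed
  have U: "?L (cheb_U_int (int n - 2 * int s)) =
      (\<Sum>m = 0..n. vwp_sum A a b c d q m / qpoch (a * b * c * d) q m * (- q) ^ m * ?I s m)" for s
    by (rule aw_functional_cheb_U_int[OF nonzero(5,6) q_generic A_generic(1,2) nonzero(1) abcd_generic])
  have "2 ^ n * aw_moment a b c d q n = ?L ([:0, 2:] ^ n)"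
    unfolding x aw_functional_smult aw_moment_def ..
  also have "\<dots> = (\<Sum>s = 0..n + 1. ballot n (int s) * (\<Sum>m = 0..n. ?C m * ?W m * (- q) ^ m * ?I s m))"
    unfolding two_x_power_cheb_U aw_functional_sum aw_functional_smult U M ..
  also have "\<dots> = (\<Sum>m = 0..n. \<Sum>s = 0..n + 1. ballot n (int s) * (?C m * ?W m * (- q) ^ m * ?I s m))"
    unfolding sum_distrib_left by (rule sum.swap)
  also have "\<dots> = (\<Sum>m = 0..n. ?C m * (- q) ^ m * ?W m * (\<Sum>s = 0..n + 1. ballot n (int s) * ?I s m))"
    unfolding sum_distrib_left[of "_ * ?W _"] by (simp only: mult_ac)
  finally show ?thesis unfolding ballot_def .
qed

end
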